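(* Let $T$ be an i.e.m. with no connection, with $s>1$, whose rotation number satisfies condition (a'). Then for any $\tau>0$ there exists $C_\tau>0$ such that, for any $\alpha\in\mathcal A$ and any $\ell\ge0$, $$|I_\alpha^{(n_\ell)}|\ge C_\tau^{-1}\,|I^{(0)}|\,\|B(0,n_k)\|^{-\tau-1},$$ where $k$ is the largest integer greater than or equal to $\ell$ such that $\sum_\beta B_{\beta\alpha}(n_\ell,n_k)<s$.
   Context: Let $\mathcal A$ be an alphabet with $d\ge2$ letters and $\pi=(\pi_t,\pi_b)$ an irreducible pair of bijections $\mathcal A\to\{1,\dots,d\}$ (irreducible: $\pi_t^{-1}(\{1,\dots,k\})\ne\pi_b^{-1}(\{1,\dots,k\})$ for $1\le k<d$). For $\lambda\in(0,\infty)^{\mathcal A}$ the interval exchange map (i.e.m.) $T=T_{\pi,\lambda}$ acts on $I=(u_0,u_d)$ of length $\sum_\alpha\lambda_\alpha$: it translates open intervals $I_\alpha$ of length $\lambda_\alpha$, ordered from left to right by $\pi_t$, onto intervals $I_\alpha^b$ of the same lengths ordered by $\pi_b$ (extended by right-continuity). The points separating the $I_\alpha$ (resp. $I_\alpha^b$) are $u_1^t<\dots<u_{d-1}^t$ (resp. $u_1^b<\dots<u_{d-1}^b$). $T$ has no connection if there are no $i,j$, $m\ge0$ with $T^m(u_j^b)=u_i^t$. $\Omega_\pi$ is the antisymmetric matrix with $\Omega_{\alpha\beta}=1$ if $\pi_t(\alpha)<\pi_t(\beta),\pi_b(\alpha)>\pi_b(\beta)$, $-1$ if $\pi_t(\alpha)>\pi_t(\beta),\pi_b(\alpha)<\pi_b(\beta)$,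 $0$ otherwise; its rank is $2g$, $H(\pi)$ is its image, and $s:=d-2g+1$ (the number of marked points of a translation surface suspending $T$). Rauzy--Veech algorithm. For $T$ with no connection, with $\pi_t(\alpha_t)=\pi_b(\alpha_b)=d$, an elementary step replaces $T$ by its first return map to $(u_0,\max(u_{d-1}^t,u_{d-1}^b))$, again an i.e.m. with no connection labelled by $\mathcal A$; the winner/loser are $\alpha_t/\alpha_b$ if $u_{d-1}^t<u_{d-1}^b$ and $\alpha_b/\alpha_t$ otherwise, and the matrix of the step is $B_\gamma=\mathrm{Id}+E_{\text{loser},\text{winner}}$. Iterating from $T=T^{(0)}$ gives i.e.m.'s $T^{(n)}$ with data $\pi^{(n)}$ on intervals $I^{(n)}$, exchanging $I_\alpha^{(n)}$; the rotation number is the path $\gamma_1\star\gamma_2\star\cdots$ of successive steps and $B(m,n)=B_{\gamma_n}\cdots B_{\gamma_{m+1}}$. $\|B\|=\max_\alpha\sum_\beta|B_{\alpha\beta}|$. Sequence $(n_k)$ and condition (a'): let $\mathcal C=(0,\infty)^{\mathcal A}$, $\mathcal C(\pi)=\mathcal C\cap H(\pi)$, $n_0=0$, and $n_k$ the smallest $n>n_{k-1}$ such that $\overline{B(n_{k-1},n)(\mathcal C(\pi^{(n_{k-1})}))}\subset\mathcal C(\pi^{(n)})\cup\{0\}$. Condition (a'): for all $\tau>0$ there is $C_\tau>0$ with $\|B(n_{k-1},n_k)\|\le C_\tau\|B(n_0,n_{k-1})\|^\tau$ for all $k>0$. *)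

theory Defs
  imports "HOL-Analysis.Analysis"
begin

section \<open>Combinatorial data\<close>

definition irreducible_pair :: "('a::finite \<Rightarrow> nat) \<Rightarrow> ('a \<Rightarrow> nat) \<Rightarrow> bool" where
  "irreducible_pair pt pb \<longleftrightarrow>
     bij_betw pt UNIV {1..CARD('a)} \<and> bij_betw pb UNIV {1..CARD('a)} \<and>
     (\<forall>k. 1 \<le> k \<and> k < CARD('a) \<longrightarrow> pt -` {1..k} \<noteq> pb -` {1..k})"

definition Omega :: "('a::finite \<Rightarrow> nat) \<Rightarrow> ('a \<Rightarrow> nat) \<Rightarrow> real^'a^'a" where
  "Omega pt pb = (\<chi> \<alpha> \<beta>.
     if pt \<alpha> < pt \<beta> \<and> pb \<alpha> > pb \<beta> then 1
     else if pt \<alpha> > pt \<beta> \<and> pb \<alpha> < pb \<beta> then -1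
     else 0)"

definition H_space :: "('a::finite \<Rightarrow> nat) \<Rightarrow> ('a \<Rightarrow> nat) \<Rightarrow> (real^'a) set" where
  "H_space pt pb = range (\<lambda>v. Omega pt pb *v v)"

(* s = d - 2g + 1, where 2g is the rank of Omega; the addition comes first so that the
   subtraction on nat never truncates (rank \<le> d). *)
definition marked_points :: "('a::finite \<Rightarrow> nat) \<Rightarrow> ('a \<Rightarrow> nat) \<Rightarrow> nat" where
  "marked_points pt pb = CARD('a) + 1 - rank (Omega pt pb)"

definition pos_cone :: "(real^'a::finite) set" where
  "pos_cone = {v. \<forall>\<alpha>. v $ \<alpha> > 0}"

definition H_cone :: "('a::finite \<Rightarrow> nat) \<Rightarrow> ('a \<Rightarrow> nat) \<Rightarrow> (real^'a) set" where
  "H_cone pt pb = pos_cone \<inter> H_space pt pb"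


section \<open>Interval exchange maps\<close>

record ('a::finite) iem =
  org :: real        (* the left endpoint of the interval *)
  pit :: "'a \<Rightarrow> nat"
  pib :: "'a \<Rightarrow> nat"
  len :: "real^'a"

definition is_iem :: "('a::finite) iem \<Rightarrow> bool" where
  "is_iem T \<longleftrightarrow> CARD('a) \<ge> 2 \<and> irreducible_pair (pit T) (pib T) \<and> len T \<in> pos_cone"

definition total_len :: "('a::finite) iem \<Rightarrow> real" where
  "total_len T = (\<Sum>\<alpha>\<in>UNIV. len T $ \<alpha>)"

definition left_end :: "real \<Rightarrow> ('a::finite \<Rightarrow> nat) \<Rightarrow> real^'a \<Rightarrow> 'a \<Rightarrow> real" where
  "left_end u p l \<alpha> = u + (\<Sum>\<beta> | p \<beta> < p \<alpha>. l $ \<beta>)"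

(* The intervals are taken closed on the left and open on the right: this is the extension
   of the map by right-continuity. *)
definition top_int :: "('a::finite) iem \<Rightarrow> 'a \<Rightarrow> real set" where
  "top_int T \<alpha> = {left_end (org T) (pit T) (len T) \<alpha> ..<
                  left_end (org T) (pit T) (len T) \<alpha> + len T $ \<alpha>}"

(* Only meaningful on [u_0, u_d), which the map sends bijectively to itself. *)
definition iem_map :: "('a::finite) iem \<Rightarrow> real \<Rightarrow> real" where
  "iem_map T x = (let \<alpha> = (THE \<alpha>. x \<in> top_int T \<alpha>) in
     x - left_end (org T) (pit T) (len T) \<alpha> + left_end (org T) (pib T) (len T) \<alpha>)"

definition sep_top :: "('a::finite) iem \<Rightarrow> nat \<Rightarrow> real" where
  "sep_top T i = org T + (\<Sum>\<beta> | pit T \<beta> \<le> i. len T $ \<beta>)"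

definition sep_bot :: "('a::finite) iem \<Rightarrow> nat \<Rightarrow> real" where
  "sep_bot T j = org T + (\<Sum>\<beta> | pib T \<beta> \<le> j. len T $ \<beta>)"

definition no_connection :: "('a::finite) iem \<Rightarrow> bool" where
  "no_connection T \<longleftrightarrow>
     \<not> (\<exists>i j m. 1 \<le> i \<and> i < CARD('a) \<and> 1 \<le> j \<and> j < CARD('a) \<and>
          (iem_map T ^^ m) (sep_bot T j) = sep_top T i)"


section \<open>The Rauzy-Veech algorithm\<close>

definition last_top :: "('a::finite) iem \<Rightarrow> 'a" where
  "last_top T = (THE \<alpha>. pit T \<alpha> = CARD('a))"

definition last_bot :: "('a::finite) iem \<Rightarrow> 'a" where
  "last_bot T = (THE \<alpha>. pib T \<alpha> = CARD('a))"

definition top_wins :: "('a::finite) iem \<Rightarrow> bool" where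
  "top_wins T \<longleftrightarrow> sep_top T (CARD('a) - 1) < sep_bot T (CARD('a) - 1)"

definition winner :: "('a::finite) iem \<Rightarrow> 'a" where
  "winner T = (if top_wins T then last_top T else last_bot T)"

definition loser :: "('a::finite) iem \<Rightarrow> 'a" where
  "loser T = (if top_wins T then last_bot T else last_top T)"

(* In the ordering p, in which l comes last, move l to the place just after w. *)
definition move_after :: "('a \<Rightarrow> nat) \<Rightarrow> 'a \<Rightarrow> 'a \<Rightarrow> 'a \<Rightarrow> nat" where
  "move_after p w l \<alpha> = (if \<alpha> = l then p w + 1 else if p \<alpha> \<le> p w then p \<alpha> else p \<alpha> + 1)"

(* The data of the first return map of T to the interval from u_0 to
   max (u_{d-1}^t) (u_{d-1}^b); the theorem rauzy_step_first_return below shows that it is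
   indeed that map.  The labelling is the one for which the interval of the loser visits the
   intervals of the loser and of the winner before returning, while that of any other letter
   visits only its own, as encoded in step_matrix. *)
definition rauzy_step :: "('a::finite) iem \<Rightarrow> 'a iem" where
  "rauzy_step T =
     T \<lparr> pit := (if top_wins T then pit T else move_after (pit T) (winner T) (loser T)),
         pib := (if top_wins T then move_after (pib T) (winner T) (loser T) else pib T),
         len := (\<chi> \<alpha>. if \<alpha> = winner T then len T $ winner T - len T $ loser T
                      else len T $ \<alpha>) \<rparr>"

definition step_matrix :: "('a::finite) iem \<Rightarrow> real^'a^'a" where
  "step_matrix T = mat 1 + (\<chi> \<alpha> \<beta>. if \<alpha> = loser T \<and> \<beta> = winner T then 1 else 0)"

definition RV :: "('a::finite) iem \<Rightarrow> nat \<Rightarrow> 'a iem" where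
  "RV T n = (rauzy_step ^^ n) T"

(* B(m,n) for m \<le> n; the n-th step of the path is the one from RV T (n-1) to RV T n. *)
primrec RV_matrix :: "('a::finite) iem \<Rightarrow> nat \<Rightarrow> nat \<Rightarrow> real^'a^'a" where
  "RV_matrix T m 0 = mat 1"
| "RV_matrix T m (Suc n) =
     (if Suc n \<le> m then mat 1 else step_matrix (RV T n) ** RV_matrix T m n)"

definition mnorm :: "real^'a^'a::finite \<Rightarrow> real" where
  "mnorm B = Max (range (\<lambda>\<alpha>. \<Sum>\<beta>\<in>UNIV. \<bar>B $ \<alpha> $ \<beta>\<bar>))"

definition cone_at :: "('a::finite) iem \<Rightarrow> nat \<Rightarrow> (real^'a) set" where
  "cone_at T n = H_cone (pit (RV T n)) (pib (RV T n))"

primrec nseq :: "('a::finite) iem \<Rightarrow> nat \<Rightarrow> nat" where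
  "nseq T 0 = 0"
| "nseq T (Suc k) = (LEAST n. n > nseq T k \<and>
     closure ((\<lambda>v. RV_matrix T (nseq T k) n *v v) ` cone_at T (nseq T k))
       \<subseteq> cone_at T n \<union> {0})"

definition condition_a' :: "('a::finite) iem \<Rightarrow> bool" where
  "condition_a' T \<longleftrightarrow>
     (\<forall>\<tau>>0. \<exists>C>0. \<forall>k>0.
        mnorm (RV_matrix T (nseq T (k - 1)) (nseq T k))
          \<le> C * mnorm (RV_matrix T (nseq T 0) (nseq T (k - 1))) powr \<tau>)"

section \<open>The elementary step is a first return map\<close>

definition first_return :: "('b \<Rightarrow> 'b) \<Rightarrow> 'b set \<Rightarrow> 'b \<Rightarrow> 'b" where
  "first_return f J x = (f ^^ (LEAST m. m > 0 \<and> (f ^^ m) x \<in> J)) x"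

lemma left_end_add_le:
  fixes l :: "real^'a::finite"
  assumes "\<And>\<alpha>. l $ \<alpha> > 0" "p \<alpha> < p \<beta>"
  shows "left_end u p l \<alpha> + l $ \<alpha> \<le> left_end u p l \<beta>"
proof -
  have "(\<Sum>\<gamma> | p \<gamma> < p \<alpha>. l $ \<gamma>) + l $ \<alpha> = (\<Sum>\<gamma>\<in>insert \<alpha> {\<gamma>. p \<gamma> < p \<alpha>}. l $ \<gamma>)"
    by (subst sum.insert) auto
  also have "\<dots> \<le> (\<Sum>\<gamma> | p \<gamma> < p \<beta>. l $ \<gamma>)"
    using assms by (intro sum_mono2) (auto simp: less_imp_le)
  finally show ?thesis by (simp add: left_end_def)
qed

lemma left_end_total:
  fixes l :: "real^'a::finite"
  assumes "bij_betw p UNIV {1..CARD('a)}" "p \<alpha> = CARD('a)"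
  shows "left_end u p l \<alpha> + l $ \<alpha> = u + (\<Sum>\<gamma>\<in>UNIV. l $ \<gamma>)"
proof -
  have "p \<gamma> < p \<alpha>" if "\<gamma> \<noteq> \<alpha>" for \<gamma>
    using assms that by (metis bij_betwE UNIV_I atLeastAtMost_iff bij_betw_imp_inj_on injD le_neq_implies_less)
  then have "insert \<alpha> {\<gamma>. p \<gamma> < p \<alpha>} = UNIV" by auto
  then have "(\<Sum>\<gamma>\<in>UNIV. l $ \<gamma>) = (\<Sum>\<gamma>\<in>insert \<alpha> {\<gamma>. p \<gamma> < p \<alpha>}. l $ \<gamma>)" by simp
  also have "\<dots> = l $ \<alpha> + (\<Sum>\<gamma> | p \<gamma> < p \<alpha>. l $ \<gamma>)" by (subst sum.insert) auto
  finally show ?thesis by (simp add: left_end_def)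
qed

lemma left_end_nonneg: "(\<And>\<alpha>. l $ \<alpha> > 0) \<Longrightarrow> u \<le> left_end u p (l :: real^'a::finite) \<alpha>"
  by (auto simp: left_end_def less_imp_le intro!: sum_nonneg)

lemma iem_map_eq:
  assumes "is_iem T" "x \<in> top_int T \<alpha>"
  shows "iem_map T x = x - left_end (org T) (pit T) (len T) \<alpha> + left_end (org T) (pib T) (len T) \<alpha>"
proof -
  have pos: "\<And>\<alpha>. len T $ \<alpha> > 0" using assms by (auto simp: is_iem_def pos_cone_def)
  have inj: "inj (pit T)" using assms by (auto simp: is_iem_def irreducible_pair_def bij_betw_def)
  have "\<beta> = \<alpha>" if "x \<in> top_int T \<beta>" for \<beta>
  proof (rule ccontr)
    assume "\<beta> \<noteq> \<alpha>"
    then have "pit T \<alpha> < pit T \<beta> \<or> pit T \<beta> < pit T \<alpha>" using inj by (metis injD linorder_neqE_nat)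
    then show False
      using left_end_add_le[of "len T" "pit T" \<alpha> \<beta> "org T", OF pos]
        left_end_add_le[of "len T" "pit T" \<beta> \<alpha> "org T", OF pos] assms(2) that
      by (auto simp: top_int_def)
  qed
  then have "(THE \<alpha>. x \<in> top_int T \<alpha>) = \<alpha>" using assms(2) by blast
  then show ?thesis by (simp add: iem_map_def)
qed

lemma left_end_move_after:
  fixes l :: "real^'a::finite"
  assumes bij: "bij_betw p UNIV {1..CARD('a)}" and z: "p z = CARD('a)" and wz: "w \<noteq> z"
  defines "l' \<equiv> (\<chi> \<alpha>. if \<alpha> = w then l $ w - l $ z else l $ \<alpha>)"
  shows "left_end u (move_after p w z) l' \<alpha> =
           (if \<alpha> = z then left_end u p l w + l $ w - l $ z else left_end u p l \<alpha>)"
    (is "?L = ?R")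
proof -
  have inj: "p x = p y \<longleftrightarrow> x = y" for x y using bij by (auto simp: bij_betw_def inj_eq)
  have lt: "p \<gamma> < p z" if "\<gamma> \<noteq> z" for \<gamma>
    using bij z that inj by (metis bij_betwE UNIV_I atLeastAtMost_iff le_neq_implies_less)
  have l': "(\<Sum>\<gamma>\<in>S. l' $ \<gamma>) = (\<Sum>\<gamma>\<in>S. l $ \<gamma>) - (if w \<in> S then l $ z else 0)" for S
  proof -
    have "(\<Sum>\<gamma>\<in>S. l' $ \<gamma>) = (\<Sum>\<gamma>\<in>S. l $ \<gamma> - (if \<gamma> = w then l $ z else 0))"
      by (intro sum.cong) (auto simp: l'_def)
    then show ?thesis by (simp add: sum_subtractf sum.delta)
  qed
  consider (z) "\<alpha> = z" | (le) "\<alpha> \<noteq> z" "p \<alpha> \<le> p w" | (gt) "\<alpha> \<noteq> z" "p w < p \<alpha>" by linarith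
  then show ?thesis
  proof cases
    case z
    have S: "{\<gamma>. move_after p w z \<gamma> < move_after p w z \<alpha>} = insert w {\<gamma>. p \<gamma> < p w}"
      using lt[OF wz] by (auto simp: move_after_def z inj split: if_splits)
         (metis inj le_neq_implies_less)+
    show ?thesis unfolding left_end_def S l' using z by (subst sum.insert) auto
  next
    case le
    have S: "{\<gamma>. move_after p w z \<gamma> < move_after p w z \<alpha>} = {\<gamma>. p \<gamma> < p \<alpha>}"
      using le lt[OF wz] lt[OF le(1)] by (auto simp: move_after_def split: if_splits)
    show ?thesis unfolding left_end_def S l' using le by auto
  next
    case gt
    have S: "{\<gamma>. move_after p w z \<gamma> < move_after p w z \<alpha>} = insert z {\<gamma>. p \<gamma> < p \<alpha>}"
      using gt lt[OF wz] lt[OF gt(1)] by (auto simp: move_after_def split: if_splits)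
    show ?thesis unfolding left_end_def S l' using gt lt[OF gt(1)] by (subst sum.insert) auto
  qed
qed

lemma left_end_last_fixed:
  fixes l :: "real^'a::finite"
  assumes bij: "bij_betw p UNIV {1..CARD('a)}" and w: "p w = CARD('a)"
  shows "left_end u p (\<chi> \<alpha>. if \<alpha> = w then c else l $ \<alpha>) \<alpha> = left_end u p l \<alpha>"
proof -
  have "p \<alpha> \<le> p w" using bij w by (metis bij_betwE UNIV_I atLeastAtMost_iff)
  then show ?thesis unfolding left_end_def by (intro arg_cong2[of _ _ _ _ "(+)"] sum.cong) auto
qed

lemma first_return_1:
  assumes "f x \<in> J"
  shows "first_return f J x = f x"
proof -
  have "(LEAST m. m > 0 \<and> (f ^^ m) x \<in> J) = 1"
    by (rule Least_equality) (use assms in auto)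
  then show ?thesis by (simp add: first_return_def)
qed

lemma first_return_2:
  assumes "f x \<notin> J" "f (f x) \<in> J"
  shows "first_return f J x = f (f x)"
proof -
  have "(LEAST m. m > 0 \<and> (f ^^ m) x \<in> J) = 2"
  proof (rule Least_equality)
    fix y assume "0 < y \<and> (f ^^ y) x \<in> J"
    then show "2 \<le> y" using assms(1) by (cases "y = 1") auto
  qed (use assms in \<open>auto simp: numeral_2_eq_2\<close>)
  then show ?thesis by (simp add: first_return_def numeral_2_eq_2)
qed

lemma top_int_cover:
  assumes "is_iem T" "org T \<le> x" "x < org T + total_len T"
  shows "\<exists>\<alpha>. x \<in> top_int T \<alpha>"
proof -
  let ?L = "left_end (org T) (pit T) (len T)"
  have bij: "bij_betw (pit T) UNIV {1..CARD('a)}"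
    using assms by (auto simp: is_iem_def irreducible_pair_def)
  have "\<forall>\<alpha>. pit T \<alpha> = n \<longrightarrow> x < ?L \<alpha> + len T $ \<alpha> \<longrightarrow> (\<exists>\<alpha>. x \<in> top_int T \<alpha>)" for n
  proof (induction n)
    case 0
    then show ?case using bij by (metis bij_betwE UNIV_I atLeastAtMost_iff not_one_le_zero)
  next
    case (Suc n)
    show ?case
    proof (intro allI impI)
      fix \<alpha> assume a: "pit T \<alpha> = Suc n" "x < ?L \<alpha> + len T $ \<alpha>"
      show "\<exists>\<alpha>. x \<in> top_int T \<alpha>"
      proof (cases "?L \<alpha> \<le> x")
        case True
        then show ?thesis using a by (auto simp: top_int_def)
      next
        case False
        have "n \<noteq> 0"
        proof
          assume "n = 0"
          moreover have "1 \<le> pit T \<beta>" for \<beta> using bij by (metis bij_betwE UNIV_I atLeastAtMost_iff)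
          ultimately have e: "{\<beta>. pit T \<beta> < pit T \<alpha>} = {}" using a \<open>n = 0\<close>
            by (simp add: Suc_le_eq)
          then have "?L \<alpha> = org T" unfolding left_end_def e by simp
          then show False using False assms(2) by simp
        qed
        moreover have "Suc n \<le> CARD('a)" using a bij by (metis bij_betwE UNIV_I atLeastAtMost_iff)
        ultimately have "n \<in> pit T ` UNIV" using bij by (auto simp: bij_betw_def)
        then obtain \<beta> where b: "pit T \<beta> = n" by auto
        have e: "{\<gamma>. pit T \<gamma> < pit T \<alpha>} = insert \<beta> {\<gamma>. pit T \<gamma> < pit T \<beta>}"
          using a b bij by (auto simp: less_Suc_eq bij_betw_def inj_eq)
        have "?L \<alpha> = ?L \<beta> + len T $ \<beta>" unfolding left_end_def e by (subst sum.insert) auto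
        then show ?thesis using Suc b False by auto
      qed
    qed
  qed
  moreover obtain z where "pit T z = CARD('a)"
    using bij assms(1) by (metis (no_types, lifting) Suc_1 Suc_leD atLeastAtMost_iff bij_betw_def imageE is_iem_def One_nat_def order_refl)
  ultimately show ?thesis
    using left_end_total[OF bij] assms(3) unfolding total_len_def by metis
qed

lemma bij_move_after:
  fixes p :: "'a::finite \<Rightarrow> nat"
  assumes bij: "bij_betw p UNIV {1..CARD('a)}" and z: "p z = CARD('a)" and wz: "w \<noteq> z"
  shows "bij_betw (move_after p w z) UNIV {1..CARD('a)}"
proof -
  have inj: "p x = p y \<longleftrightarrow> x = y" for x y using bij by (auto simp: bij_betw_def inj_eq)
  have rng: "1 \<le> p \<gamma>" "p \<gamma> \<le> CARD('a)" for \<gamma>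
    using bij by (metis bij_betwE UNIV_I atLeastAtMost_iff)+
  have lt: "p \<gamma> < CARD('a)" if "\<gamma> \<noteq> z" for \<gamma>
    using rng(2)[of \<gamma>] z inj that by (metis le_neq_implies_less)
  have 1: "inj (move_after p w z)"
    by (rule injI) (auto simp: move_after_def inj split: if_splits)
  have "move_after p w z \<gamma> \<in> {1..CARD('a)}" for \<gamma>
    using rng(1)[of \<gamma>] rng(2)[of \<gamma>] lt[of \<gamma>] lt[OF wz] by (auto simp: move_after_def)
  then have "range (move_after p w z) \<subseteq> {1..CARD('a)}" by blast
  moreover have "card (range (move_after p w z)) = CARD('a)" using 1 by (rule card_image)
  ultimately have "range (move_after p w z) = {1..CARD('a)}"
    by (intro card_subset_eq) auto
  with 1 show ?thesis by (simp add: bij_betw_def)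
qed

lemma vimage_move_after:
  assumes "p z = CARD('a)" "k < p w" "p w \<le> CARD('a)"
  shows "move_after p w (z::'a::finite) -` {1..k} = p -` {1..k}"
  using assms by (auto simp: move_after_def split: if_splits)

context
  fixes T :: "('a::finite) iem"
  assumes iem: "is_iem T"
    and no_tie: "sep_top T (CARD('a) - 1) \<noteq> sep_bot T (CARD('a) - 1)"
begin

lemma step_facts:
  shows "bij_betw (pit T) UNIV {1..CARD('a)}" "bij_betw (pib T) UNIV {1..CARD('a)}"
    and "pit T (last_top T) = CARD('a)" "pib T (last_bot T) = CARD('a)"
    and "len T $ \<alpha> > 0"
    and "sep_top T (CARD('a) - 1) = org T + total_len T - len T $ last_top T"
    and "sep_bot T (CARD('a) - 1) = org T + total_len T - len T $ last_bot T"
    and "winner T \<noteq> loser T" "len T $ loser T < len T $ winner T"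
    and "max (sep_top T (CARD('a) - 1)) (sep_bot T (CARD('a) - 1))
           = org T + total_len T - len T $ loser T"
proof -
  show b: "bij_betw (pit T) UNIV {1..CARD('a)}" "bij_betw (pib T) UNIV {1..CARD('a)}"
    using iem by (auto simp: is_iem_def irreducible_pair_def)
  have ex: "\<exists>!\<alpha>. p \<alpha> = CARD('a)" if "bij_betw p (UNIV::'a set) {1..CARD('a)}" for p
  proof -
    have "CARD('a) \<in> range p" using that by (auto simp: bij_betw_def Suc_le_eq)
    then obtain \<alpha> where "p \<alpha> = CARD('a)" by (metis imageE)
    then show ?thesis using that by (metis bij_betw_imp_inj_on injD)
  qed
  show l: "pit T (last_top T) = CARD('a)" "pib T (last_bot T) = CARD('a)"
    unfolding last_top_def last_bot_def using theI'[OF ex[OF b(1)]] theI'[OF ex[OF b(2)]] by auto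
  show "len T $ \<alpha> > 0" using iem by (auto simp: is_iem_def pos_cone_def)
  have "p \<gamma> \<le> CARD('a) - 1 \<longleftrightarrow> p \<gamma> < CARD('a)" for p and \<gamma> :: 'a
    using zero_less_card_finite[where 'a='a] by linarith
  then have e: "{\<gamma>. p \<gamma> \<le> CARD('a) - 1} = {\<gamma>. p \<gamma> < CARD('a)}" for p :: "'a \<Rightarrow> nat"
    by blast
  show t: "sep_top T (CARD('a) - 1) = org T + total_len T - len T $ last_top T"
    using left_end_total[OF b(1) l(1), of "org T" "len T"]
    unfolding sep_top_def e total_len_def left_end_def l by simp
  show u: "sep_bot T (CARD('a) - 1) = org T + total_len T - len T $ last_bot T"
    using left_end_total[OF b(2) l(2), of "org T" "len T"]
    unfolding sep_bot_def e total_len_def left_end_def l by simp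
  show lw: "len T $ loser T < len T $ winner T"
    using no_tie t u by (auto simp: winner_def loser_def top_wins_def)
  then show "winner T \<noteq> loser T" by auto
  show "max (sep_top T (CARD('a) - 1)) (sep_bot T (CARD('a) - 1))
           = org T + total_len T - len T $ loser T"
    using t u by (auto simp: loser_def top_wins_def)
qed

lemma is_iem_rauzy_step: "is_iem (rauzy_step T)"
proof -
  note f = step_facts
  have irr: "pit T -` {1..k} \<noteq> pib T -` {1..k}" if "1 \<le> k" "k < CARD('a)" for k
    using iem that by (auto simp: is_iem_def irreducible_pair_def)
  have rng: "pit T \<alpha> \<le> CARD('a)" "pib T \<alpha> \<le> CARD('a)" for \<alpha>
    using f(1,2) by (metis bij_betwE UNIV_I atLeastAtMost_iff)+
  have pos: "len (rauzy_step T) \<in> pos_cone"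
    using f(5,9) by (auto simp: pos_cone_def rauzy_step_def)
  have irr': "pit (rauzy_step T) -` {1..k} \<noteq> pib (rauzy_step T) -` {1..k}"
    if k: "1 \<le> k" "k < CARD('a)" for k
  proof (cases "top_wins T")
    case True
    have w: "winner T = last_top T" "loser T = last_bot T"
      using True by (auto simp: winner_def loser_def)
    show ?thesis
    proof
      assume a: "pit (rauzy_step T) -` {1..k} = pib (rauzy_step T) -` {1..k}"
      have "winner T \<notin> pit T -` {1..k}" using f(3) k w by auto
      then have "winner T \<notin> move_after (pib T) (winner T) (loser T) -` {1..k}"
        using arg_cong[OF a, of "\<lambda>S. winner T \<in> S"] True
        by (simp add: rauzy_step_def del: vimage_eq)
      moreover have "1 \<le> pib T (winner T)"
        using f(2) by (metis bij_betwE UNIV_I atLeastAtMost_iff)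
      ultimately have "k < pib T (winner T)" using f(8) by (auto simp: move_after_def)
      then have "move_after (pib T) (winner T) (loser T) -` {1..k} = pib T -` {1..k}"
        using f(4) w rng by (intro vimage_move_after) auto
      then show False using a True irr[OF k] by (simp add: rauzy_step_def)
    qed
  next
    case False
    have w: "winner T = last_bot T" "loser T = last_top T"
      using False by (auto simp: winner_def loser_def)
    show ?thesis
    proof
      assume a: "pit (rauzy_step T) -` {1..k} = pib (rauzy_step T) -` {1..k}"
      have "winner T \<notin> pib T -` {1..k}" using f(4) k w by auto
      then have "winner T \<notin> move_after (pit T) (winner T) (loser T) -` {1..k}"
        using arg_cong[OF a, of "\<lambda>S. winner T \<in> S"] False
        by (simp add: rauzy_step_def del: vimage_eq)
      moreover have "1 \<le> pit T (winner T)"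
        using f(1) by (metis bij_betwE UNIV_I atLeastAtMost_iff)
      ultimately have "k < pit T (winner T)" using f(8) by (auto simp: move_after_def)
      then have "move_after (pit T) (winner T) (loser T) -` {1..k} = pit T -` {1..k}"
        using f(3) w rng by (intro vimage_move_after) auto
      then show False using a False irr[OF k] by (simp add: rauzy_step_def)
    qed
  qed
  have "bij_betw (pit (rauzy_step T)) UNIV {1..CARD('a)}"
    using f(1,3,8) bij_move_after[of "pit T" "loser T" "winner T"]
    by (auto simp: rauzy_step_def loser_def winner_def)
  moreover have "bij_betw (pib (rauzy_step T)) UNIV {1..CARD('a)}"
    using f(2,4,8) bij_move_after[of "pib T" "loser T" "winner T"]
    by (auto simp: rauzy_step_def loser_def winner_def)
  ultimately show ?thesis
    using irr' pos iem by (auto simp: is_iem_def irreducible_pair_def)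
qed

lemma total_len_rauzy_step: "total_len (rauzy_step T) = total_len T - len T $ loser T"
proof -
  have "total_len (rauzy_step T)
      = (\<Sum>\<alpha>\<in>UNIV. len T $ \<alpha> - (if \<alpha> = winner T then len T $ loser T else 0))"
    unfolding total_len_def by (intro sum.cong) (auto simp: rauzy_step_def)
  then show ?thesis by (simp add: sum_subtractf total_len_def)
qed

lemma len_rauzy_step: "len T = len (rauzy_step T) v* step_matrix T"
proof -
  let ?l = "len (rauzy_step T)"
  have "(?l v* step_matrix T) $ \<beta> = len T $ \<beta>" for \<beta>
  proof -
    have "(?l v* step_matrix T) $ \<beta>
        = (\<Sum>\<alpha>\<in>UNIV. (if \<alpha> = \<beta> then ?l $ \<alpha> else 0)
             + (if \<alpha> = loser T then (if \<beta> = winner T then ?l $ \<alpha> else 0) else 0))"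
      unfolding vector_matrix_mult_def step_matrix_def
      by (auto simp: mat_def algebra_simps intro!: sum.cong)
    also have "\<dots> = ?l $ \<beta> + (if \<beta> = winner T then ?l $ loser T else 0)"
      by (simp add: sum.distrib)
    finally show ?thesis using step_facts(8) by (auto simp: rauzy_step_def)
  qed
  then show ?thesis by (simp add: vec_eq_iff)
qed

theorem rauzy_step_first_return:
  defines "J \<equiv> {org T ..< max (sep_top T (CARD('a) - 1)) (sep_bot T (CARD('a) - 1))}"
  shows "{org (rauzy_step T) ..< org (rauzy_step T) + total_len (rauzy_step T)} = J"
    and "x \<in> J \<Longrightarrow> iem_map (rauzy_step T) x = first_return (iem_map T) J x"
proof -
  note f = step_facts
  let ?w = "winner T" and ?l = "loser T" and ?T = "rauzy_step T"
  let ?Lt = "left_end (org T) (pit T) (len T)" and ?Lb = "left_end (org T) (pib T) (len T)"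
  let ?Mt = "left_end (org ?T) (pit ?T) (len ?T)" and ?Mb = "left_end (org ?T) (pib ?T) (len ?T)"
  have J: "J = {org T ..< org T + total_len T - len T $ ?l}" unfolding J_def f(10) ..
  show JT: "{org ?T ..< org ?T + total_len ?T} = J"
    unfolding J total_len_rauzy_step by (simp add: rauzy_step_def algebra_simps)
  assume x: "x \<in> J"
  then obtain \<alpha> where \<alpha>: "x \<in> top_int ?T \<alpha>"
    using top_int_cover[OF is_iem_rauzy_step, of x] JT by (metis atLeastLessThan_iff)
  have R: "iem_map ?T x = x - ?Mt \<alpha> + ?Mb \<alpha>" by (rule iem_map_eq[OF is_iem_rauzy_step \<alpha>])
  have len': "len ?T = (\<chi> \<beta>. if \<beta> = ?w then len T $ ?w - len T $ ?l else len T $ \<beta>)"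
    by (simp add: rauzy_step_def)
  have lenx: "len ?T $ \<beta> = (if \<beta> = ?w then len T $ ?w - len T $ ?l else len T $ \<beta>)" for \<beta>
    by (simp add: len')
  have lw: "len T $ ?l < len T $ ?w" "?w \<noteq> ?l" "0 < len T $ ?l" using f(5,8,9) by auto
  have Tmap: "iem_map T y = y - ?Lt \<beta> + ?Lb \<beta>"
    if "?Lt \<beta> \<le> y" "y < ?Lt \<beta> + len T $ \<beta>" for y \<beta>
    using that by (intro iem_map_eq[OF iem]) (auto simp: top_int_def)
  have x': "?Mt \<alpha> \<le> x" "x < ?Mt \<alpha> + len ?T $ \<alpha>" using \<alpha> by (auto simp: top_int_def)
  have lo: "org T \<le> ?Lb \<beta>" "org T \<le> ?Lt \<beta>" for \<beta> by (intro left_end_nonneg f(5))+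
  have ltb: "pib T \<beta> < pib T (last_bot T)" if "\<beta> \<noteq> last_bot T" for \<beta>
    using f(2,4) that by (metis bij_betwE UNIV_I atLeastAtMost_iff bij_betw_imp_inj_on injD le_neq_implies_less)
  show "iem_map ?T x = first_return (iem_map T) J x"
  proof (cases "top_wins T")
    case True
    then have wl: "?w = last_top T" "?l = last_bot T" by (auto simp: winner_def loser_def)
    have Mt: "?Mt \<beta> = ?Lt \<beta>" for \<beta>
      using left_end_last_fixed[OF f(1,3)] True unfolding len' wl by (simp add: rauzy_step_def wl)
    have Mb: "?Mb \<beta> = (if \<beta> = ?l then ?Lb ?w + len T $ ?w - len T $ ?l else ?Lb \<beta>)" for \<beta>
      using left_end_move_after[OF f(2,4), of ?w "org T" "len T" \<beta>] True lw(2)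
      unfolding len' wl by (simp add: rauzy_step_def wl)
    have et: "?Lt ?w + len T $ ?w = org T + total_len T"
      using left_end_total[OF f(1,3)] by (simp add: total_len_def wl)
    have eb: "?Lb ?l + len T $ ?l = org T + total_len T"
      using left_end_total[OF f(2,4)] by (simp add: total_len_def wl)
    have bnd: "?Lb \<beta> + len T $ \<beta> \<le> ?Lb ?l" if "\<beta> \<noteq> ?l" for \<beta>
      using left_end_add_le[of "len T" "pib T" \<beta> "last_bot T" "org T"] f(5) ltb[of \<beta>] that
      by (simp add: wl)
    show ?thesis
    proof (cases "\<alpha> = ?l")
      case False
      have xx: "?Lt \<alpha> \<le> x" "x < ?Lt \<alpha> + len T $ \<alpha>"
        using x' lw unfolding Mt lenx by (auto split: if_splits)
      have "iem_map T x \<in> J"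
        using Tmap[OF xx] xx bnd[OF False] eb lo(1)[of \<alpha>] unfolding J by auto
      then show ?thesis unfolding first_return_1[of "iem_map T", OF \<open>iem_map T x \<in> J\<close>] R Tmap[OF xx] using False by (simp add: Mt Mb)
    next
      case al: True
      have xx: "?Lt ?l \<le> x" "x < ?Lt ?l + len T $ ?l"
        using x' lw unfolding Mt lenx al by (auto split: if_splits)
      define y where "y = iem_map T x"
      have y: "y = x - ?Lt ?l + ?Lb ?l" unfolding y_def by (rule Tmap[OF xx])
      have yy: "?Lt ?w \<le> y" "y < ?Lt ?w + len T $ ?w" "y \<notin> J"
        using y xx et eb lw unfolding J by auto
      have z: "iem_map T y = y - ?Lt ?w + ?Lb ?w" by (rule Tmap[OF yy(1,2)])
      have "iem_map T y \<in> J" unfolding z J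
        using yy bnd[OF lw(2)] eb lo(1)[of ?w] by auto
      then have "first_return (iem_map T) J x = iem_map T y"
        using first_return_2[of "iem_map T" x J] yy(3) by (simp add: y_def)
      then show ?thesis unfolding R Mt Mb z al using y et eb by simp
    qed
  next
    case False
    then have wl: "?w = last_bot T" "?l = last_top T" by (auto simp: winner_def loser_def)
    have Mb: "?Mb \<beta> = ?Lb \<beta>" for \<beta>
      using left_end_last_fixed[OF f(2,4)] False unfolding len' wl by (simp add: rauzy_step_def wl)
    have Mt: "?Mt \<beta> = (if \<beta> = ?l then ?Lt ?w + len T $ ?w - len T $ ?l else ?Lt \<beta>)" for \<beta>
      using left_end_move_after[OF f(1,3), of ?w "org T" "len T" \<beta>] False lw(2)
      unfolding len' wl by (simp add: rauzy_step_def wl)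
    have et: "?Lt ?l + len T $ ?l = org T + total_len T"
      using left_end_total[OF f(1,3)] by (simp add: total_len_def wl)
    have eb: "?Lb ?w + len T $ ?w = org T + total_len T"
      using left_end_total[OF f(2,4)] by (simp add: total_len_def wl)
    have bnd: "?Lb \<beta> + len T $ \<beta> \<le> ?Lb ?w" if "\<beta> \<noteq> ?w" for \<beta>
      using left_end_add_le[of "len T" "pib T" \<beta> "last_bot T" "org T"] f(5) ltb[of \<beta>] that
      by (simp add: wl)
    show ?thesis
    proof (cases "\<alpha> = ?l")
      case al: False
      have xx: "?Lt \<alpha> \<le> x" "x < ?Lt \<alpha> + len ?T $ \<alpha>"
        using x' al unfolding Mt by auto
      have xx2: "x < ?Lt \<alpha> + len T $ \<alpha>"
        using xx lw unfolding lenx by (auto split: if_splits)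
      have "x - ?Lt \<alpha> + ?Lb \<alpha> < org T + total_len T - len T $ ?l"
        using xx eb bnd[of \<alpha>] lw unfolding lenx by (cases "\<alpha> = ?w") auto
      then have "iem_map T x \<in> J"
        using Tmap[OF xx(1) xx2] xx lo(1)[of \<alpha>] unfolding J by auto
      then show ?thesis unfolding first_return_1[of "iem_map T", OF \<open>iem_map T x \<in> J\<close>] R Tmap[OF xx(1) xx2] using al by (simp add: Mt Mb)
    next
      case al: True
      have x2: "?Lt ?w + len T $ ?w - len T $ ?l \<le> x" "x < ?Lt ?w + len T $ ?w"
        using x' lw unfolding Mt lenx al by (auto split: if_splits)
      then have xx: "?Lt ?w \<le> x" using lw by auto
      define y where "y = iem_map T x"
      have y: "y = x - ?Lt ?w + ?Lb ?w" unfolding y_def by (rule Tmap[OF xx x2(2)])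
      have yy: "?Lt ?l \<le> y" "y < ?Lt ?l + len T $ ?l" "y \<notin> J"
        using y x2 et eb lw unfolding J by auto
      have z: "iem_map T y = y - ?Lt ?l + ?Lb ?l" by (rule Tmap[OF yy(1,2)])
      have "iem_map T y \<in> J" unfolding z J
        using yy bnd[of ?l] lw eb lo(1)[of ?l] by auto
      then have "first_return (iem_map T) J x = iem_map T y"
        using first_return_2[of "iem_map T" x J] yy(3) by (simp add: y_def)
      then show ?thesis unfolding R Mt Mb z al using y et eb by simp
    qed
  qed
qed

end

end

theory Submission
  imports Defs
begin

text \<open>
  Write \<open>\<lambda>\<close> for the length vector of \<open>T\<close> at time \<open>n\<close> and \<open>B(m,n)\<close> for the matrix from time \<open>m\<close> to time \<open>n\<close>.
  The lengths at time \<open>m\<close> are \<open>\<lambda> B(m,n)\<close>.  Hence an interval at time \<open>m\<close> whose column in \<open>B(m,n)\<close>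
  has no zero entry is at least as long as the whole interval at time \<open>n\<close>, which in turn has at
  least the initial length divided by the norm of \<open>B(0,n)\<close>.  The estimate follows once the column of
  \<open>\<alpha>\<close> from time \<open>n_l\<close> to time \<open>n_(k+2)\<close> is known to be positive: condition (a'), used for the two
  steps from \<open>n_k\<close> to \<open>n_(k+2)\<close>, replaces the norm of \<open>B(0,n_(k+2))\<close> by that of \<open>B(0,n_k)\<close> at the
  price of an arbitrarily small increase of the exponent.

  Positivity of the column comes from a graph.  The image \<open>H\<close> of \<open>\<Omega>\<close> is the orthogonal complement
  of the kernel of \<open>\<Omega>\<close>, and this kernel consists of the vectors \<open>\<delta>\<close> which, used as (signed)
  lengths, give an exchange all of whose translations are zero.  The partial sums of such a \<open>\<delta>\<close> form a
  potential on the endpoints of the intervals that top and bottom share; endpoints at which all these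
  potentials agree are the marked points, and there are at most \<open>s\<close> of them.  A letter is an edge
  from the marked point at its left end to the one at its right end, and a vector of edge
  multiplicities lies in \<open>H\<close> as soon as its edges form a closed path (\<open>H_space_orthogonal\<close>).
  An elementary step cuts the edge of the winner into an edge of the winner followed by an edge of the
  loser, so a column of \<open>B(m,n)\<close> always counts the edges of a path
  (\<open>RV_matrix_column_path\<close>).  If its entries add up to at least \<open>s\<close>, the path meets some
  marked point twice and contains a closed path (\<open>long_path_closed_subpath\<close>).  The edge count of
  the latter is a nonzero integer vector in \<open>H\<close> with nonnegative entries, and the times \<open>n_k\<close> are
  chosen such that the next accelerated step makes it positive (\<open>nseq_step_positive\<close>).

  That the times \<open>n_k\<close> exist, and that column sums grow beyond \<open>s\<close>, rests on \<open>B(m,n)\<close> being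
  eventually positive (\<open>RV_matrix_positive\<close>).  Absence of connections is inherited by the induced
  map, so the algorithm never stops.  Every letter wins infinitely often, because letters that stop
  winning end up filling the same initial segment of both rows, which irreducibility excludes
  (\<open>winner_infinitely_often\<close>).  The letters at which a given column becomes positive then include the
  loser whenever they include the winner, and two successive steps share a letter; a proper subset
  with this property could not go on winning.
\<close>

section \<open>The kernel and the image of \<open>\<Omega>\<close>\<close>

lemma bij_range:
  assumes "bij_betw p (UNIV :: 'a::finite set) {1..CARD('a)}"
  shows "1 \<le> p \<alpha>" "p \<alpha> \<le> CARD('a)" "inj p"
  using assms by (auto simp: bij_betw_def)

lemma is_iem_inj:
  assumes "is_iem T"
  shows "inj (pit T)" "inj (pib T)"
  using assms by (auto simp: is_iem_def irreducible_pair_def bij_betw_def)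

text \<open>For positive \<open>\<delta>\<close>, \<open>left_end 0 pb \<delta> \<alpha> - left_end 0 pt \<delta> \<alpha>\<close> is the translation of the interval \<open>\<alpha>\<close>
  under the exchange with lengths \<open>\<delta>\<close>.  This set is the kernel of \<open>\<Omega>\<close>, in the form in which its behaviour
  under an elementary step can be computed.\<close>

definition translation_free :: "('a::finite \<Rightarrow> nat) \<Rightarrow> ('a \<Rightarrow> nat) \<Rightarrow> (real^'a) set" where
  "translation_free pt pb = {\<delta>. \<forall>\<alpha>. left_end 0 pt \<delta> \<alpha> = left_end 0 pb \<delta> \<alpha>}"

text \<open>The letters to the left of \<open>\<alpha>\<close> in both orders cancel on the right-hand side; the others are those on
  which the two orders disagree.\<close>

lemma Omega_mult_component:
  assumes "inj pt" "inj pb"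
  shows "(Omega pt pb *v \<delta>) $ \<alpha> = left_end 0 pb \<delta> \<alpha> - left_end 0 pt \<delta> \<alpha>"
proof -
  have eq: "pt \<beta> = pt \<alpha> \<longleftrightarrow> \<beta> = \<alpha>" "pb \<beta> = pb \<alpha> \<longleftrightarrow> \<beta> = \<alpha>" for \<beta>
    using assms by (auto simp: inj_eq)
  have "left_end 0 p \<delta> \<alpha> = (\<Sum>\<beta>\<in>UNIV. if p \<beta> < p \<alpha> then \<delta> $ \<beta> else 0)" for p
    by (simp add: left_end_def sum.If_cases)
  then have "left_end 0 pb \<delta> \<alpha> - left_end 0 pt \<delta> \<alpha> =
      (\<Sum>\<beta>\<in>UNIV. (if pb \<beta> < pb \<alpha> then \<delta> $ \<beta> else 0) - (if pt \<beta> < pt \<alpha> then \<delta> $ \<beta> else 0))"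
    by (simp add: sum_subtractf)
  also have "\<dots> = (\<Sum>\<beta>\<in>UNIV. Omega pt pb $ \<alpha> $ \<beta> * \<delta> $ \<beta>)"
  proof (intro sum.cong refl)
    fix \<beta>
    consider "\<beta> = \<alpha>" | "pt \<beta> \<noteq> pt \<alpha>" "pb \<beta> \<noteq> pb \<alpha>" using eq by blast
    then show "(if pb \<beta> < pb \<alpha> then \<delta> $ \<beta> else 0) - (if pt \<beta> < pt \<alpha> then \<delta> $ \<beta> else 0)
        = Omega pt pb $ \<alpha> $ \<beta> * \<delta> $ \<beta>"
      by cases (auto simp: Omega_def)
  qed
  finally show ?thesis by (simp add: matrix_vector_mult_def)
qed

lemma translation_free_iff_Omega:
  assumes "inj pt" "inj pb"
  shows "\<delta> \<in> translation_free pt pb \<longleftrightarrow> Omega pt pb *v \<delta> = 0"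
  using Omega_mult_component[OF assms] by (auto simp: translation_free_def vec_eq_iff)

lemma transpose_Omega: "transpose (Omega pt pb) = - Omega pt pb"
  by (auto simp: transpose_def Omega_def vec_eq_iff)

lemma Omega_antisym: "(Omega pt pb *v x) \<bullet> y = - (x \<bullet> (Omega pt pb *v y))"
proof -
  have "(Omega pt pb *v x) \<bullet> y = x \<bullet> (transpose (Omega pt pb) *v y)"
    by (metis dot_lmul_matrix transpose_matrix_vector transpose_transpose)
  also have "\<dots> = - (x \<bullet> (Omega pt pb *v y))"
    unfolding transpose_Omega by (metis inner_minus_right scaleR_matrix_vector_assoc scaleR_minus1_left)
  finally show ?thesis .
qed

lemma subspace_H_space: "subspace (H_space pt pb)"
  unfolding H_space_def by (intro linear_subspace_image matrix_vector_mul_linear subspace_UNIV)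

text \<open>\<open>\<Omega>\<close> is antisymmetric, so its kernel is the orthogonal complement of its image.\<close>

lemma translation_free_orthogonal:
  assumes "inj pt" "inj pb"
  shows "translation_free pt pb = {\<delta>. \<forall>h\<in>H_space pt pb. orthogonal h \<delta>}"
proof -
  have "(\<forall>h\<in>H_space pt pb. orthogonal h \<delta>) \<longleftrightarrow> (\<forall>x. x \<bullet> (Omega pt pb *v \<delta>) = 0)" for \<delta>
    by (simp add: H_space_def orthogonal_def Omega_antisym)
  also have "\<dots> \<delta> \<longleftrightarrow> Omega pt pb *v \<delta> = 0" for \<delta>
    by (metis inner_eq_zero_iff inner_zero_right)
  finally show ?thesis using translation_free_iff_Omega[OF assms] by blast
qed

text \<open>This dual description is how vectors are shown to lie in the image of \<open>\<Omega>\<close> below.\<close>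

lemma H_space_orthogonal:
  assumes "inj pt" "inj pb"
  shows "v \<in> H_space pt pb \<longleftrightarrow> (\<forall>\<delta>\<in>translation_free pt pb. v \<bullet> \<delta> = 0)"
proof
  assume "\<forall>\<delta>\<in>translation_free pt pb. v \<bullet> \<delta> = 0"
  moreover obtain y z where yz: "y \<in> span (H_space pt pb)"
      "\<And>w. w \<in> span (H_space pt pb) \<Longrightarrow> orthogonal z w" "v = y + z"
    using orthogonal_subspace_decomp_exists[of "H_space pt pb" v] by metis
  moreover have "z \<in> translation_free pt pb"
    using yz(2) unfolding translation_free_orthogonal[OF assms]
    by (auto simp: orthogonal_commute span_base)
  ultimately have "z \<bullet> z = 0"
    by (metis add_cancel_left_left inner_add_left inner_commute orthogonal_def)
  then show "v \<in> H_space pt pb"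
    using yz(1,3) by (simp add: span_eq_iff[THEN iffD2, OF subspace_H_space])
qed (use translation_free_orthogonal[OF assms] in \<open>auto simp: orthogonal_def\<close>)

lemma marked_points_eq_dim:
  assumes "inj pt" "inj (pb :: 'a::finite \<Rightarrow> nat)"
  shows "marked_points pt pb = dim (translation_free pt pb) + 1"
proof -
  have "dim {y \<in> UNIV. \<forall>x\<in>H_space pt pb. orthogonal x y} + dim (H_space pt pb) = dim (UNIV::(real^'a) set)"
    by (intro dim_subspace_orthogonal_to_vectors subspace_H_space) auto
  then have "dim (translation_free pt pb) + rank (Omega pt pb) = CARD('a)"
    using translation_free_orthogonal[OF assms] by (simp add: H_space_def rank_dim_range)
  then show ?thesis by (simp add: marked_points_def)
qed

section \<open>Marked points\<close>

definition partial_sum :: "('a::finite \<Rightarrow> nat) \<Rightarrow> real^'a \<Rightarrow> nat \<Rightarrow> real" where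
  "partial_sum p \<delta> i = (\<Sum>\<beta> | p \<beta> \<le> i. \<delta> $ \<beta>)"

text \<open>Two endpoints of intervals count as the same marked point when every \<open>\<delta>\<close> in the kernel has the same
  partial sum at both.  A marked point is encoded by its evaluation functional on the kernel, restricted
  there so that equality of functions is this identification.\<close>

definition vertex :: "('a::finite \<Rightarrow> nat) \<Rightarrow> ('a \<Rightarrow> nat) \<Rightarrow> nat \<Rightarrow> real^'a \<Rightarrow> real" where
  "vertex pt pb i = restrict (\<lambda>\<delta>. partial_sum pt \<delta> i) (translation_free pt pb)"

lemma left_end_partial_sum:
  assumes "bij_betw p (UNIV :: 'a::finite set) {1..CARD('a)}"
  shows "left_end 0 p \<delta> \<alpha> = partial_sum p \<delta> (p \<alpha> - 1)"
    and "left_end 0 p \<delta> \<alpha> + \<delta> $ \<alpha> = partial_sum p \<delta> (p \<alpha>)"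
proof -
  note r = bij_range[OF assms]
  have "\<And>\<beta>. p \<beta> < p \<alpha> \<longleftrightarrow> p \<beta> \<le> p \<alpha> - 1" using r(1)[of \<alpha>] by auto
  then show "left_end 0 p \<delta> \<alpha> = partial_sum p \<delta> (p \<alpha> - 1)"
    by (simp add: left_end_def partial_sum_def)
  have "{\<beta>. p \<beta> \<le> p \<alpha>} = insert \<alpha> {\<beta>. p \<beta> < p \<alpha>}" using r(3) by (auto simp: le_less inj_eq)
  then show "left_end 0 p \<delta> \<alpha> + \<delta> $ \<alpha> = partial_sum p \<delta> (p \<alpha>)"
    by (simp add: left_end_def partial_sum_def)
qed

lemma partial_sum_0:
  assumes "bij_betw p (UNIV :: 'a::finite set) {1..CARD('a)}"
  shows "partial_sum p \<delta> 0 = 0"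
  using bij_range(1)[OF assms] unfolding partial_sum_def
  by (intro sum.neutral) (metis le_zero_eq mem_Collect_eq not_one_le_zero)

text \<open>A function on the endpoints is the partial sum of its increments, whichever bijection orders the
  letters.\<close>

lemma partial_sum_telescope:
  fixes g :: "nat \<Rightarrow> real"
  assumes "bij_betw p (UNIV :: 'a::finite set) {1..CARD('a)}" "i \<le> CARD('a)"
  shows "partial_sum p (\<chi> \<beta>. g (p \<beta>) - g (p \<beta> - 1)) i = g i - g 0"
proof -
  have "bij_betw p {\<beta>. p \<beta> \<le> i} {1..i}"
  proof -
    have "p ` {\<beta>. p \<beta> \<le> i} = {1..i}"
    proof
      show "{1..i} \<subseteq> p ` {\<beta>. p \<beta> \<le> i}"
      proof
        fix x assume x: "x \<in> {1..i}"
        then have "x \<in> p ` UNIV" using assms by (auto simp: bij_betw_def)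
        then show "x \<in> p ` {\<beta>. p \<beta> \<le> i}" using x by auto
      qed
    qed (use bij_range[OF assms(1)] in auto)
    then show ?thesis using assms(1) by (auto simp: bij_betw_def inj_on_def)
  qed
  then have "(\<Sum>\<beta> | p \<beta> \<le> i. g (p \<beta>) - g (p \<beta> - 1)) = (\<Sum>j\<in>{1..i}. g j - g (j - 1))"
    by (rule sum.reindex_bij_betw)
  also have "\<dots> = g i - g 0" by (induction i) auto
  finally show ?thesis by (simp add: partial_sum_def)
qed

text \<open>A function on the marked points that vanishes at the leftmost endpoint is the potential of a vector in
  the kernel, because top and bottom endpoints of a letter represent the same marked points.  The vectors
  obtained from the indicator functions are therefore independent, and the kernel has dimension
  \<open>s - 1\<close>.\<close>

lemma card_vertices_le:
  assumes "bij_betw pt (UNIV :: 'a::finite set) {1..CARD('a)}" "bij_betw pb (UNIV :: 'a set) {1..CARD('a)}"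
  shows "card (vertex pt pb ` {..CARD('a)}) \<le> marked_points pt pb"
proof -
  note inj = bij_range(3)[OF assms(1)] bij_range(3)[OF assms(2)]
  let ?K = "translation_free pt pb" and ?v = "vertex pt pb"
  \<comment> \<open>The endpoints of the bottom intervals define the same potentials as those of the top intervals.\<close>
  define vb where "vb = (\<lambda>i. restrict (\<lambda>\<delta>. partial_sum pb \<delta> i) ?K)"
  have vb: "vb (pb \<alpha>) = ?v (pt \<alpha>)" "vb (pb \<alpha> - 1) = ?v (pt \<alpha> - 1)" "vb 0 = ?v 0" for \<alpha>
    unfolding vb_def vertex_def
    by (rule restrict_ext;
        simp add: left_end_partial_sum[OF assms(1), symmetric] left_end_partial_sum[OF assms(2), symmetric]
          partial_sum_0[OF assms(1)] partial_sum_0[OF assms(2)] translation_free_def del: One_nat_def)+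
  define V where "V = ?v ` {..CARD('a)} - {?v 0}"
  \<comment> \<open>The coboundary of the indicator function of \<open>c\<close>.  As \<open>c\<close> is not the vertex of the left endpoint,
    the indicator function is recovered from it by partial sums.\<close>
  define ind :: "(real^'a \<Rightarrow> real) \<Rightarrow> real^'a" where
    "ind c = (\<chi> \<alpha>. of_bool (?v (pt \<alpha>) = c) - of_bool (?v (pt \<alpha> - 1) = c))" for c
  have ind_b: "ind c = (\<chi> \<alpha>. of_bool (vb (pb \<alpha>) = c) - of_bool (vb (pb \<alpha> - 1) = c))" for c
    by (simp only: ind_def vb)
  have Pt: "partial_sum pt (ind c) i = of_bool (?v i = c)" if "c \<in> V" "i \<le> CARD('a)" for c i
    using partial_sum_telescope[OF assms(1) that(2), of "\<lambda>i. of_bool (?v i = c)"] that(1)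
    by (auto simp: ind_def V_def)
  have Pb: "partial_sum pb (ind c) i = of_bool (vb i = c)" if "c \<in> V" "i \<le> CARD('a)" for c i
    using partial_sum_telescope[OF assms(2) that(2), of "\<lambda>i. of_bool (vb i = c)"] that(1) vb(3)
    by (auto simp: ind_b V_def)
  have mem: "ind c \<in> ?K" if "c \<in> V" for c
    unfolding translation_free_def
  proof (clarify)
    fix \<alpha>
    have "pt \<alpha> - 1 \<le> CARD('a)" "pb \<alpha> - 1 \<le> CARD('a)"
      using bij_range(2)[OF assms(1), of \<alpha>] bij_range(2)[OF assms(2), of \<alpha>] by linarith+
    then show "left_end 0 pt (ind c) \<alpha> = left_end 0 pb (ind c) \<alpha>"
      by (simp only: left_end_partial_sum(1)[OF assms(1)] left_end_partial_sum(1)[OF assms(2)]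
          Pt[OF that] Pb[OF that] vb)
  qed
  have fin: "finite V" by (simp add: V_def)
  have "\<exists>i\<le>CARD('a). ?v i = c" if "c \<in> V" for c using that by (auto simp: V_def)
  then obtain pos where pos: "\<And>c. c \<in> V \<Longrightarrow> pos c \<le> CARD('a) \<and> ?v (pos c) = c" by metis
  have dual: "partial_sum pt (ind c) (pos c') = of_bool (c' = c)" if "c \<in> V" "c' \<in> V" for c c'
    using Pt[OF that(1)] pos[OF that(2)] by simp
  have inj_ind: "inj_on ind V"
    by (rule inj_onI) (metis dual of_bool_eq(1,2) zero_neq_one)
  have "independent (ind ` V)"
  proof (rule independent_if_scalars_zero)
    show "finite (ind ` V)" using fin by simp
    fix f x assume f: "(\<Sum>x\<in>ind ` V. f x *\<^sub>R x) = 0" and x: "x \<in> ind ` V"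
    then obtain c where c: "c \<in> V" "x = ind c" by blast
    have "0 = partial_sum pt (\<Sum>c\<in>V. f (ind c) *\<^sub>R ind c) (pos c)"
      using f by (simp add: sum.reindex[OF inj_ind] partial_sum_def)
    also have "\<dots> = (\<Sum>c'\<in>V. f (ind c') * partial_sum pt (ind c') (pos c))"
      unfolding partial_sum_def by (simp add: sum_distrib_left) (rule sum.swap)
    also have "\<dots> = (\<Sum>c'\<in>V. if c' = c then f (ind c') else 0)"
      using c(1) by (intro sum.cong) (auto simp: dual)
    also have "\<dots> = f (ind c)" using c(1) fin by simp
    finally show "f x = 0" using c(2) by simp
  qed
  then have "card (ind ` V) \<le> dim ?K" by (intro independent_card_le_dim) (use mem in auto)
  then have "card V \<le> dim ?K" by (simp add: card_image[OF inj_ind])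
  moreover have "card V = card (?v ` {..CARD('a)}) - 1"
    unfolding V_def by (subst card_Diff_singleton) auto
  ultimately show ?thesis using marked_points_eq_dim[OF inj] by linarith
qed

section \<open>Paths of letters\<close>

text \<open>Each letter is an edge from the marked point at its left end to the one at its right end; consecutive
  edges have to meet.\<close>

definition edge_path :: "('a::finite \<Rightarrow> nat) \<Rightarrow> ('a \<Rightarrow> nat) \<Rightarrow> 'a list \<Rightarrow> bool" where
  "edge_path pt pb xs \<longleftrightarrow> (\<forall>\<delta>\<in>translation_free pt pb.
     successively (\<lambda>\<alpha> \<beta>. left_end 0 pt \<delta> \<alpha> + \<delta> $ \<alpha> = left_end 0 pt \<delta> \<beta>) xs)"

definition occurrences :: "'a::finite list \<Rightarrow> real^'a" where
  "occurrences xs = (\<Sum>x\<leftarrow>xs. axis x 1)"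

lemma occurrences_simps [simp]:
  "occurrences [] = 0" "occurrences (x # xs) = axis x 1 + occurrences xs"
  "occurrences (xs @ ys) = occurrences xs + occurrences ys"
  by (auto simp: occurrences_def)

lemma occurrences_Nats: "occurrences xs $ \<alpha> \<in> \<nat>"
  by (induction xs) (auto simp: axis_def)

lemma sum_occurrences: "(\<Sum>\<alpha>\<in>UNIV. occurrences xs $ \<alpha>) = length xs"
  by (induction xs) (auto simp: sum.distrib axis_def)

text \<open>A sum along a path telescopes to the difference of the potential between its ends.\<close>

lemma path_prefix_sum:
  assumes bij: "bij_betw pt (UNIV :: 'a::finite set) {1..CARD('a)}"
  assumes "successively (\<lambda>\<alpha> \<beta>. left_end 0 pt \<delta> \<alpha> + \<delta> $ \<alpha> = left_end 0 pt \<delta> \<beta>) (x # xs)"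
  shows "occurrences (x # xs) \<bullet> \<delta> = partial_sum pt \<delta> (pt (last (x # xs))) - partial_sum pt \<delta> (pt x - 1)"
  unfolding left_end_partial_sum(1)[OF bij, symmetric] left_end_partial_sum(2)[OF bij, symmetric]
  using assms(2)
proof (induction xs arbitrary: x)
  case (Cons y xs)
  then show ?case by (simp add: inner_add_left inner_axis' split: if_splits)
qed (simp add: inner_axis')

text \<open>A path with at least as many edges as there are marked points returns to one of them.  Along the closed
  piece every potential has total change zero, so its edge count is orthogonal to the kernel.\<close>

theorem long_path_closed_subpath:
  assumes bij: "bij_betw pt (UNIV :: 'a::finite set) {1..CARD('a)}" "bij_betw pb (UNIV :: 'a set) {1..CARD('a)}"
    and p: "edge_path pt pb xs" and len: "length xs \<ge> marked_points pt pb"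
  shows "\<exists>as ys bs. xs = as @ ys @ bs \<and> ys \<noteq> [] \<and> occurrences ys \<in> H_space pt pb"
proof -
  note inj = bij_range(3)[OF bij(1)] bij_range(3)[OF bij(2)]
  let ?K = "translation_free pt pb" and ?v = "vertex pt pb"
  have "marked_points pt pb > 0" using marked_points_eq_dim[OF inj] by simp
  then have ne: "xs \<noteq> []" using len by auto
  then obtain x xs' where xs: "xs = x # xs'" by (cases xs) auto
  \<comment> \<open>\<open>Q i\<close> is the change of potential along the first \<open>i\<close> edges, and \<open>pos i\<close> an endpoint which they
    lead to.\<close>
  define Q where "Q i = restrict (\<lambda>\<delta>. occurrences (take i xs) \<bullet> \<delta>) ?K" for i
  define pos where "pos i = (if i = 0 then pt x - 1 else pt (last (take i xs)))" for i
  have pos: "pos i \<le> CARD('a)" for i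
    using bij_range(2)[OF bij(1)] by (auto simp: pos_def intro: le_trans[of _ "pt x"])
  have "Q i = (\<lambda>c. restrict (\<lambda>\<delta>. c \<delta> - ?v (pt x - 1) \<delta>) ?K) (?v (pos i))" for i
    unfolding Q_def
  proof (rule restrict_ext)
    fix \<delta> assume d: "\<delta> \<in> ?K"
    show "occurrences (take i xs) \<bullet> \<delta> = ?v (pos i) \<delta> - ?v (pt x - 1) \<delta>"
    proof (cases i)
      case (Suc i')
      have "successively (\<lambda>\<alpha> \<beta>. left_end 0 pt \<delta> \<alpha> + \<delta> $ \<alpha> = left_end 0 pt \<delta> \<beta>) (take i xs @ drop i xs)"
        using p d by (simp add: edge_path_def)
      then have "successively (\<lambda>\<alpha> \<beta>. left_end 0 pt \<delta> \<alpha> + \<delta> $ \<alpha> = left_end 0 pt \<delta> \<beta>) (x # take i' xs')"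
        unfolding successively_append_iff by (simp add: xs Suc)
      from path_prefix_sum[OF bij(1) this] show ?thesis
        using d by (simp add: xs Suc vertex_def pos_def)
    qed (simp add: pos_def)
  qed
  \<comment> \<open>There are \<open>length xs + 1\<close> prefixes but fewer marked points.\<close>
  then have "Q ` {..length xs} \<subseteq> (\<lambda>c. restrict (\<lambda>\<delta>. c \<delta> - ?v (pt x - 1) \<delta>) ?K) ` ?v ` {..CARD('a)}"
    using pos by blast
  then have "card (Q ` {..length xs}) \<le> card (?v ` {..CARD('a)})"
    by (meson card_image_le card_mono finite_atMost finite_imageI order_trans)
  also have "\<dots> < card {..length xs}" using card_vertices_le[OF bij] len by simp
  finally have "\<not> inj_on Q {..length xs}" using card_image by force
  then obtain i j where ij: "i < j" "j \<le> length xs" "Q i = Q j"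
    unfolding inj_on_def by (metis atMost_iff linorder_neqE_nat)
  define ys where "ys = drop i (take j xs)"
  have t: "take j xs = take i xs @ ys"
    using ij unfolding ys_def by (metis append_take_drop_id less_imp_le min.absorb1 take_take)
  have "xs = take i xs @ ys @ drop j xs" by (metis t append.assoc append_take_drop_id)
  moreover have "ys \<noteq> []" using ij by (simp add: ys_def)
  moreover have "occurrences ys \<bullet> \<delta> = 0" if "\<delta> \<in> ?K" for \<delta>
    using fun_cong[OF ij(3), of \<delta>] that unfolding Q_def by (simp add: t inner_add_left)
  then have "occurrences ys \<in> H_space pt pb" using H_space_orthogonal[OF inj] by blast
  ultimately show ?thesis by blast
qed

section \<open>Positive vectors in the image of \<open>\<Omega>\<close>\<close>

text \<open>Among the sets of \<open>k\<close> letters, the first \<open>k\<close> in the order \<open>q\<close> have the smallest sum of positions.\<close>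

lemma sum_positions_le:
  assumes p: "bij_betw p (UNIV :: 'a::finite set) {1..CARD('a)}" and q: "bij_betw q (UNIV :: 'a set) {1..CARD('a)}"
    and k: "k \<le> CARD('a)"
  shows "(\<Sum>\<beta> | p \<beta> \<le> k. p \<beta>) \<le> (\<Sum>\<beta> | p \<beta> \<le> k. q \<beta>)"
    and "p -` {1..k} \<noteq> q -` {1..k} \<Longrightarrow> (\<Sum>\<beta> | p \<beta> \<le> k. p \<beta>) < (\<Sum>\<beta> | p \<beta> \<le> k. q \<beta>)"
proof -
  define A where "A = p -` {1..k}"
  define A' where "A' = q -` {1..k}"
  have "bij_betw p A {1..k}" "bij_betw q A' {1..k}"
    using p q k unfolding A_def A'_def bij_betw_def
    by (auto simp: inj_on_def image_vimage_eq)
  then have s: "sum p A = sum q A'" and c: "card A = card A'"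
    using sum.reindex_bij_betw[of p A "{1..k}" "\<lambda>x. x"] sum.reindex_bij_betw[of q A' "{1..k}" "\<lambda>x. x"]
      bij_betw_same_card by (metis, metis)
  have c': "card (A - A') = card (A' - A)"
    using c by (metis card_Diff_subset_Int finite inf_commute)
  \<comment> \<open>Passing from \<open>A'\<close> to \<open>A\<close> replaces letters with \<open>q \<le> k\<close> by equally many letters with \<open>q > k\<close>.\<close>
  have outside: "Suc k \<le> q i" if "i \<in> A - A'" for i
    using that bij_range(1)[OF q, of i] by (auto simp: A'_def not_le Suc_le_eq)
  have "sum q A' = sum q (A \<inter> A') + sum q (A' - A)"
    by (metis finite inf_commute sum.Int_Diff)
  also have "\<dots> \<le> sum q (A \<inter> A') + card (A' - A) * k"
    using sum_bounded_above[of "A' - A" q k] by (auto simp: A'_def)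
  also have "\<dots> + card (A - A') = sum q (A \<inter> A') + card (A - A') * Suc k" using c' by simp
  also have "\<dots> \<le> sum q (A \<inter> A') + sum q (A - A')"
    using sum_bounded_below[of "A - A'" "Suc k" q] outside by simp
  also have "\<dots> = sum q A" by (metis finite sum.Int_Diff)
  finally have le: "sum p A + card (A - A') \<le> sum q A" using s by simp
  have A: "A = {\<beta>. p \<beta> \<le> k}" using bij_range(1)[OF p] by (auto simp: A_def)
  show "(\<Sum>\<beta> | p \<beta> \<le> k. p \<beta>) \<le> (\<Sum>\<beta> | p \<beta> \<le> k. q \<beta>)"
    using le unfolding A by simp
  assume "p -` {1..k} \<noteq> q -` {1..k}"
  then have "A - A' \<noteq> {}"
    using c unfolding A_def[symmetric] A'_def[symmetric]
    by (metis Diff_eq_empty_iff card_seteq finite order_refl)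
  then have "card (A - A') > 0" by (simp add: card_gt_0_iff)
  then show "(\<Sum>\<beta> | p \<beta> \<le> k. p \<beta>) < (\<Sum>\<beta> | p \<beta> \<le> k. q \<beta>)"
    using le unfolding A by linarith
qed

text \<open>Without a positive vector in the image of \<open>\<Omega>\<close> the condition that defines the accelerated times would
  be vacuous.  The witness is \<open>\<Omega>\<close> applied to the differences of the two positions of each letter.\<close>

lemma H_cone_nonempty:
  assumes "irreducible_pair pt (pb :: 'a::finite \<Rightarrow> nat)" "CARD('a) \<ge> 2"
  shows "\<exists>v. v \<in> H_cone pt pb"
proof -
  have b: "bij_betw pt UNIV {1..CARD('a)}" "bij_betw pb UNIV {1..CARD('a)}"
    and irr: "\<And>k. 1 \<le> k \<Longrightarrow> k < CARD('a) \<Longrightarrow> pt -` {1..k} \<noteq> pb -` {1..k}"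
    using assms(1) by (auto simp: irreducible_pair_def)
  \<comment> \<open>At interior endpoints its partial sums are positive in the top order and negative in the bottom
    order, which are the inequalities for the heights of a suspension.\<close>
  define \<tau> :: "real^'a" where "\<tau> = (\<chi> \<beta>. real (pb \<beta>) - real (pt \<beta>))"
  have ps: "partial_sum p \<tau> k = real (\<Sum>\<beta> | p \<beta> \<le> k. pb \<beta>) - real (\<Sum>\<beta> | p \<beta> \<le> k. pt \<beta>)" for p k
    by (simp add: partial_sum_def \<tau>_def sum_subtractf)
  have t: "partial_sum pt \<tau> k \<ge> 0" "k \<ge> 1 \<Longrightarrow> partial_sum pt \<tau> k > 0" if "k < CARD('a)" for k
    using sum_positions_le[OF b, of k] irr[of k] that unfolding ps by (simp_all del: of_nat_sum)
  have u: "partial_sum pb \<tau> k \<le> 0" "k \<ge> 1 \<Longrightarrow> partial_sum pb \<tau> k < 0" if "k < CARD('a)" for k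
    using sum_positions_le[OF b(2,1), of k] not_sym[OF irr[of k]] that unfolding ps by (simp_all del: of_nat_sum)
  have "(Omega pt pb *v - \<tau>) $ \<alpha> > 0" for \<alpha>
  proof -
    have "(Omega pt pb *v - \<tau>) $ \<alpha> = partial_sum pt \<tau> (pt \<alpha> - 1) - partial_sum pb \<tau> (pb \<alpha> - 1)"
      using Omega_mult_component[OF bij_range(3)[OF b(1)] bij_range(3)[OF b(2)], of \<tau> \<alpha>]
      unfolding left_end_partial_sum(1)[OF b(1)] left_end_partial_sum(1)[OF b(2)]
      by (simp add: matrix_vector_mult_def sum_negf)
    moreover have "pt \<alpha> - 1 < CARD('a)" "pb \<alpha> - 1 < CARD('a)"
      using bij_range(1,2)[OF b(1), of \<alpha>] bij_range(1,2)[OF b(2), of \<alpha>] by linarith+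
    moreover have "pt \<alpha> - 1 \<ge> 1 \<or> pb \<alpha> - 1 \<ge> 1"
    proof (rule ccontr)
      assume "\<not> ?thesis"
      then have "pt \<alpha> = 1" "pb \<alpha> = 1"
        using bij_range(1)[OF b(1), of \<alpha>] bij_range(1)[OF b(2), of \<alpha>] by linarith+
      then have "pt -` {1..1} = {\<alpha>}" "pb -` {1..1} = {\<alpha>}"
        using bij_range(3)[OF b(1)] bij_range(3)[OF b(2)] by (auto simp: inj_def)
      then show False using irr[of 1] assms(2) by simp
    qed
    ultimately show ?thesis using t u by (smt (verit))
  qed
  then show ?thesis by (auto simp: H_cone_def pos_cone_def H_space_def)
qed

section \<open>The elementary step\<close>

lemma step_matrix_mult_component:
  "(step_matrix T *v v) $ \<gamma> = v $ \<gamma> + (if \<gamma> = loser T then v $ winner T else 0)"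
proof -
  have "(step_matrix T *v v) $ \<gamma>
      = (\<Sum>\<beta>\<in>UNIV. (if \<beta> = \<gamma> then v $ \<beta> else 0) + (if \<beta> = winner T then (if \<gamma> = loser T then v $ \<beta> else 0) else 0))"
    unfolding matrix_vector_mult_def step_matrix_def
    by (auto simp: mat_def algebra_simps intro!: sum.cong)
  then show ?thesis by (simp add: sum.distrib)
qed

lemma step_matrix_mult_axis:
  "step_matrix T *v axis x 1 = axis x 1 + (if x = winner T then axis (loser T) 1 else 0)"
  unfolding matrix_vector_mult_basis
  by (auto simp: vec_eq_iff step_matrix_def column_def mat_def axis_def)

lemma winner_loser_last:
  "{winner T', loser T'} = {last_top T', last_bot T'}"
  by (auto simp: winner_def loser_def)

text \<open>The winner stays last in its row.\<close>

lemma winner_persists: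
  "winner T \<in> {winner (rauzy_step T), loser (rauzy_step T)}"
proof -
  have "top_wins T \<Longrightarrow> last_top (rauzy_step T) = last_top T"
    "\<not> top_wins T \<Longrightarrow> last_bot (rauzy_step T) = last_bot T"
    by (auto simp: last_top_def last_bot_def rauzy_step_def)
  then show ?thesis unfolding winner_loser_last by (cases "top_wins T") (auto simp: winner_def)
qed

context
  fixes T :: "'a::finite iem"
  assumes iem: "is_iem T" and no_tie: "sep_top T (CARD('a) - 1) \<noteq> sep_bot T (CARD('a) - 1)"
begin

lemma vector_step_matrix_component:
  "(\<delta> v* step_matrix T) $ \<beta> = \<delta> $ \<beta> + (if \<beta> = winner T then \<delta> $ loser T else 0)"
proof -
  have "(\<delta> v* step_matrix T) $ \<beta> = \<delta> \<bullet> (step_matrix T *v axis \<beta> 1)"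
    by (simp add: dot_lmul_matrix[symmetric] inner_axis)
  then show ?thesis by (simp add: step_matrix_mult_axis inner_add_right inner_axis)
qed

text \<open>The formulas for the new endpoints are linear in the lengths, so they hold for signed lengths.  This
  serves both for vectors in the kernel of \<open>\<Omega>\<close> and for the actual interval exchange.\<close>

lemma left_end_rauzy_step:
  fixes \<delta>' :: "real^'a"
  defines "\<delta> \<equiv> \<delta>' v* step_matrix T"
  shows "left_end u (pit (rauzy_step T)) \<delta>' \<alpha> =
           (if \<not> top_wins T \<and> \<alpha> = loser T
            then left_end u (pit T) \<delta> (winner T) + \<delta> $ winner T - \<delta> $ loser T
            else left_end u (pit T) \<delta> \<alpha>)"
    and "left_end u (pib (rauzy_step T)) \<delta>' \<alpha> =
           (if top_wins T \<and> \<alpha> = loser T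
            then left_end u (pib T) \<delta> (winner T) + \<delta> $ winner T - \<delta> $ loser T
            else left_end u (pib T) \<delta> \<alpha>)"
proof -
  note f = step_facts[OF iem no_tie]
  have \<delta>': "\<delta>' = (\<chi> \<alpha>. if \<alpha> = winner T then \<delta> $ winner T - \<delta> $ loser T else \<delta> $ \<alpha>)"
    using f(8) by (auto simp: \<delta>_def vector_step_matrix_component vec_eq_iff)
  have w: "top_wins T \<Longrightarrow> pit T (winner T) = CARD('a) \<and> pib T (loser T) = CARD('a)"
    "\<not> top_wins T \<Longrightarrow> pib T (winner T) = CARD('a) \<and> pit T (loser T) = CARD('a)"
    using f(3,4) by (auto simp: winner_def loser_def)
  show "left_end u (pit (rauzy_step T)) \<delta>' \<alpha> =
           (if \<not> top_wins T \<and> \<alpha> = loser T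
            then left_end u (pit T) \<delta> (winner T) + \<delta> $ winner T - \<delta> $ loser T
            else left_end u (pit T) \<delta> \<alpha>)"
    unfolding \<delta>' using w left_end_last_fixed[OF f(1)] left_end_move_after[OF f(1) _ f(8)]
    by (cases "top_wins T") (auto simp: rauzy_step_def)
  show "left_end u (pib (rauzy_step T)) \<delta>' \<alpha> =
           (if top_wins T \<and> \<alpha> = loser T
            then left_end u (pib T) \<delta> (winner T) + \<delta> $ winner T - \<delta> $ loser T
            else left_end u (pib T) \<delta> \<alpha>)"
    unfolding \<delta>' using w left_end_last_fixed[OF f(2)] left_end_move_after[OF f(2) _ f(8)]
    by (cases "top_wins T") (auto simp: rauzy_step_def)
qed

text \<open>The transpose of the step matrix maps the new kernel to the old one and preserves the potentials at
  the left ends of the letters.  In other words, the step does not move the marked points.\<close>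

lemma translation_free_rauzy_step:
  assumes K: "\<delta>' \<in> translation_free (pit (rauzy_step T)) (pib (rauzy_step T))"
  defines "\<delta> \<equiv> \<delta>' v* step_matrix T"
  shows "\<delta> \<in> translation_free (pit T) (pib T)"
    and "left_end 0 (pit (rauzy_step T)) \<delta>' \<alpha> = left_end 0 (pit T) \<delta> \<alpha>"
    and "left_end 0 (pit T) \<delta> (loser T) + \<delta> $ loser T
           = left_end 0 (pit T) \<delta> (winner T) + \<delta> $ winner T"
proof -
  note f = step_facts[OF iem no_tie]
  note step = left_end_rauzy_step[of 0 \<delta>', folded \<delta>_def]
  have tot: "left_end 0 (pit T) \<delta> (last_top T) + \<delta> $ last_top T = (\<Sum>\<alpha>\<in>UNIV. \<delta> $ \<alpha>)"
    "left_end 0 (pib T) \<delta> (last_bot T) + \<delta> $ last_bot T = (\<Sum>\<alpha>\<in>UNIV. \<delta> $ \<alpha>)"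
    using left_end_total[OF f(1,3), of 0 \<delta>] left_end_total[OF f(2,4), of 0 \<delta>] by auto
  have K': "left_end 0 (pit (rauzy_step T)) \<delta>' \<beta> = left_end 0 (pib (rauzy_step T)) \<delta>' \<beta>" for \<beta>
    using K by (simp add: translation_free_def)
  have ne: "left_end 0 (pit T) \<delta> \<beta> = left_end 0 (pib T) \<delta> \<beta>" if "\<beta> \<noteq> loser T" for \<beta>
    using K'[of \<beta>] that unfolding step by simp
  \<comment> \<open>In the row that the step changes, the loser is last, and in the other row the winner is.  Both right
    ends are the total sum, which fixes the left end of the loser.\<close>
  have l: "left_end 0 (pit T) \<delta> (loser T) = left_end 0 (pib T) \<delta> (loser T)"
    using K'[of "loser T"] ne[OF f(8)] tot unfolding step
    by (cases "top_wins T") (auto simp: winner_def loser_def)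
  show mem: "\<delta> \<in> translation_free (pit T) (pib T)"
    unfolding translation_free_def mem_Collect_eq using ne l by metis
  show last: "left_end 0 (pit T) \<delta> (loser T) + \<delta> $ loser T
           = left_end 0 (pit T) \<delta> (winner T) + \<delta> $ winner T"
    using tot l ne[OF f(8)] by (cases "top_wins T") (auto simp: winner_def loser_def)
  then show "left_end 0 (pit (rauzy_step T)) \<delta>' \<alpha> = left_end 0 (pit T) \<delta> \<alpha>"
    unfolding step by auto
qed

text \<open>Dual to the statement on the kernels.\<close>

lemma H_space_rauzy_step:
  assumes "v \<in> H_space (pit T) (pib T)"
  shows "step_matrix T *v v \<in> H_space (pit (rauzy_step T)) (pib (rauzy_step T))"
proof -
  have "inj (pit (rauzy_step T))" "inj (pib (rauzy_step T))"
    using is_iem_inj[OF is_iem_rauzy_step[OF iem no_tie]] by auto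
  moreover have "(step_matrix T *v v) \<bullet> \<delta>' = v \<bullet> (\<delta>' v* step_matrix T)" for \<delta>'
    by (metis dot_lmul_matrix inner_commute)
  ultimately show ?thesis
    using assms translation_free_rauzy_step(1) H_space_orthogonal[OF is_iem_inj[OF iem]]
    by (simp add: H_space_orthogonal)
qed

text \<open>The transpose of the step matrix embeds the new kernel into the old one.\<close>

lemma marked_points_rauzy_step:
  "marked_points (pit (rauzy_step T)) (pib (rauzy_step T)) \<le> marked_points (pit T) (pib T)"
proof -
  let ?K' = "translation_free (pit (rauzy_step T)) (pib (rauzy_step T))"
  let ?f = "\<lambda>\<delta>'. \<delta>' v* step_matrix T"
  note inj' = is_iem_inj[OF is_iem_rauzy_step[OF iem no_tie]]
  have lin: "linear ?f"
    using matrix_vector_mul_linear[of "transpose (step_matrix T)"] by simp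
  have inj: "inj ?f"
  proof (rule injI)
    fix x y assume e: "x v* step_matrix T = y v* step_matrix T"
    have l: "x $ loser T = y $ loser T"
      using arg_cong[OF e, of "\<lambda>v. v $ loser T"] step_facts(8)[OF iem no_tie]
      by (simp add: vector_step_matrix_component)
    show "x = y"
      unfolding vec_eq_iff
    proof
      fix \<beta> show "x $ \<beta> = y $ \<beta>"
        using arg_cong[OF e, of "\<lambda>v. v $ \<beta>"] l
        by (simp add: vector_step_matrix_component split: if_splits)
    qed
  qed
  have "dim ?K' = dim (?f ` ?K')"
    by (rule dim_image_eq[OF lin, symmetric]) (use inj in \<open>auto intro: inj_on_subset\<close>)
  also have "\<dots> \<le> dim (translation_free (pit T) (pib T))"
    by (intro dim_subset image_subsetI translation_free_rauzy_step(1))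
  finally show ?thesis by (simp add: marked_points_eq_dim inj' is_iem_inj[OF iem])
qed

text \<open>The step cuts the interval of the winner: its old edge is the new one followed by the edge of the
  loser.  All other edges keep their ends.\<close>

lemma path_rauzy_step:
  fixes xs :: "'a list"
  assumes "edge_path (pit T) (pib T) xs"
  shows "edge_path (pit (rauzy_step T)) (pib (rauzy_step T))
           (concat (map (\<lambda>x. if x = winner T then [winner T, loser T] else [x]) xs))"
    (is "edge_path _ _ (?s xs)")
  unfolding edge_path_def
proof
  fix \<delta>' assume K: "\<delta>' \<in> translation_free (pit (rauzy_step T)) (pib (rauzy_step T))"
  define \<delta> where "\<delta> = \<delta>' v* step_matrix T"
  note step = translation_free_rauzy_step[OF K, folded \<delta>_def]
  let ?L = "left_end 0 (pit T) \<delta>"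
  have \<delta>: "\<delta> $ x = \<delta>' $ x + (if x = winner T then \<delta>' $ loser T else 0)" for x
    by (simp add: \<delta>_def vector_step_matrix_component)
  \<comment> \<open>The new edge of the winner ends where the edge of the loser begins.\<close>
  have wl: "?L (winner T) + \<delta>' $ winner T = ?L (loser T)"
    using step(3) step_facts(8)[OF iem no_tie] by (simp add: \<delta>)
  have "successively (\<lambda>\<alpha> \<beta>. ?L \<alpha> + \<delta> $ \<alpha> = ?L \<beta>) xs" using assms step(1) by (simp add: edge_path_def)
  then show "successively (\<lambda>\<alpha> \<beta>. left_end 0 (pit (rauzy_step T)) \<delta>' \<alpha> + \<delta>' $ \<alpha>
      = left_end 0 (pit (rauzy_step T)) \<delta>' \<beta>) (?s xs)"
    unfolding step(2)
  proof (induction xs)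
    case (Cons x xs)
    have h: "?s xs = [] \<longleftrightarrow> xs = []" "xs \<noteq> [] \<Longrightarrow> hd (?s xs) = hd xs" by (cases xs; simp)+
    show ?case
    proof (cases "xs = []")
      case True
      then show ?thesis using wl by simp
    next
      case False
      have c: "?L x + \<delta> $ x = ?L (hd xs)" and
        IH: "successively (\<lambda>\<alpha> \<beta>. ?L \<alpha> + \<delta>' $ \<alpha> = ?L \<beta>) (?s xs)"
        using Cons False by (auto simp: successively_Cons)
      have "?s (x # xs) = (if x = winner T then [winner T, loser T] else [x]) @ ?s xs" by simp
      then show ?thesis using c IH h False wl \<delta>[of x]
        by (auto simp: successively_append_iff)
    qed
  qed simp
qed

lemma occurrences_rauzy_step:
  "step_matrix T *v occurrences xs
     = occurrences (concat (map (\<lambda>x. if x = winner T then [winner T, loser T] else [x]) xs))"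
  by (induction xs) (auto simp: matrix_vector_right_distrib step_matrix_mult_axis algebra_simps)

end

section \<open>Absence of connections is inherited\<close>

lemma no_connection_no_tie:
  fixes T :: "'a::finite iem"
  assumes "is_iem T" "no_connection T"
  shows "sep_top T (CARD('a) - 1) \<noteq> sep_bot T (CARD('a) - 1)"
proof
  assume "sep_top T (CARD('a) - 1) = sep_bot T (CARD('a) - 1)"
  then have "(iem_map T ^^ 0) (sep_bot T (CARD('a) - 1)) = sep_top T (CARD('a) - 1)" by simp
  moreover have "1 \<le> CARD('a) - 1" "CARD('a) - 1 < CARD('a)" using assms(1) by (auto simp: is_iem_def)
  ultimately show False using assms(2) unfolding no_connection_def by blast
qed

lemma sep_eq_left_end:
  assumes "bij_betw p (UNIV :: 'a::finite set) {1..CARD('a)}"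
  shows "{u + (\<Sum>\<beta> | p \<beta> \<le> i. l $ \<beta>) |i. 1 \<le> i \<and> i < CARD('a)} = {left_end u p l \<alpha> |\<alpha>. p \<alpha> > 1}"
    (is "?S = ?L")
proof
  show "?S \<subseteq> ?L"
  proof clarify
    fix i assume i: "1 \<le> i" "i < CARD('a)"
    then have "Suc i \<in> p ` UNIV" using assms by (auto simp: bij_betw_def)
    then obtain \<alpha> where "p \<alpha> = Suc i" by auto
    then show "\<exists>\<alpha>. u + (\<Sum>\<beta> | p \<beta> \<le> i. l $ \<beta>) = left_end u p l \<alpha> \<and> 1 < p \<alpha>"
      using i by (intro exI[of _ \<alpha>]) (auto simp: left_end_def less_Suc_eq_le)
  qed
  show "?L \<subseteq> ?S"
  proof clarify
    fix \<alpha> assume a: "1 < p \<alpha>"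
    then have "{\<beta>. p \<beta> < p \<alpha>} = {\<beta>. p \<beta> \<le> p \<alpha> - 1}" by auto
    then have "left_end u p l \<alpha> = u + (\<Sum>\<beta> | p \<beta> \<le> p \<alpha> - 1. l $ \<beta>)" by (simp only: left_end_def)
    moreover have "1 \<le> p \<alpha> - 1" "p \<alpha> - 1 < CARD('a)" using a bij_range(2)[OF assms, of \<alpha>] by linarith+
    ultimately show "\<exists>i. left_end u p l \<alpha> = u + (\<Sum>\<beta> | p \<beta> \<le> i. l $ \<beta>) \<and> 1 \<le> i \<and> i < CARD('a)"
      by blast
  qed
qed

text \<open>Separators are rewritten as left ends of letters, whose change under a step is known.\<close>

lemma no_connection_iff:
  assumes "is_iem T"
  shows "no_connection T \<longleftrightarrow> (\<forall>\<alpha> \<beta> m. pit T \<alpha> > 1 \<longrightarrow> pib T \<beta> > 1 \<longrightarrow>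
    (iem_map T ^^ m) (left_end (org T) (pib T) (len T) \<beta>) \<noteq> left_end (org T) (pit T) (len T) \<alpha>)"
proof -
  have b: "bij_betw (pit T) UNIV {1..CARD('a)}" "bij_betw (pib T) UNIV {1..CARD('a)}"
    using assms by (auto simp: is_iem_def irreducible_pair_def)
  have "no_connection T \<longleftrightarrow> \<not> (\<exists>m. \<exists>y\<in>{sep_bot T j |j. 1 \<le> j \<and> j < CARD('a)}.
      \<exists>x\<in>{sep_top T i |i. 1 \<le> i \<and> i < CARD('a)}. (iem_map T ^^ m) y = x)"
    unfolding no_connection_def by blast
  then show ?thesis
    unfolding sep_bot_def sep_top_def sep_eq_left_end[OF b(1)] sep_eq_left_end[OF b(2)] by blast
qed

lemma left_end_in_interval:
  assumes "is_iem T" "bij_betw p UNIV {1..CARD('a)}"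
  shows "org T \<le> left_end (org T) p (len T) \<alpha>"
    and "left_end (org T) p (len T) \<alpha> + len T $ \<alpha> \<le> org T + total_len (T :: 'a::finite iem)"
proof -
  have pos: "\<And>\<alpha>. len T $ \<alpha> > 0" using assms by (auto simp: is_iem_def pos_cone_def)
  then show "org T \<le> left_end (org T) p (len T) \<alpha>" by (rule left_end_nonneg)
  have "(\<Sum>\<gamma> | p \<gamma> < p \<alpha>. len T $ \<gamma>) + len T $ \<alpha> = (\<Sum>\<gamma>\<in>insert \<alpha> {\<gamma>. p \<gamma> < p \<alpha>}. len T $ \<gamma>)"
    by (subst sum.insert) auto
  also have "\<dots> \<le> total_len T" unfolding total_len_def
    by (intro sum_mono2) (auto intro: less_imp_le[OF pos])
  finally show "left_end (org T) p (len T) \<alpha> + len T $ \<alpha> \<le> org T + total_len T"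
    by (simp add: left_end_def)
qed

lemma iem_map_in_interval:
  assumes "is_iem T" "x \<in> {org T ..< org T + total_len T}"
  shows "iem_map T x \<in> {org T ..< org T + total_len T}"
proof -
  obtain \<alpha> where a: "x \<in> top_int T \<alpha>" using top_int_cover[OF assms(1)] assms(2) by auto
  have "bij_betw (pib T) UNIV {1..CARD('a)}"
    using assms by (auto simp: is_iem_def irreducible_pair_def)
  from left_end_in_interval[OF assms(1) this, of \<alpha>] a show ?thesis
    unfolding iem_map_eq[OF assms(1) a] by (auto simp: top_int_def)
qed

text \<open>Orbits of the induced map are contained in orbits of the original one.  The bottom separators of the
  induced map lie on forward orbits of old ones, and its top separators on backward orbits.  A
  connection of the induced map is thus part of one of the original map.\<close>

theorem no_connection_rauzy_step:
  fixes T :: "'a::finite iem"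
  assumes iem: "is_iem T" and nc: "no_connection T"
  shows "no_connection (rauzy_step T)"
proof -
  let ?T = "rauzy_step T"
  let ?w = "winner T" and ?l = "loser T"
  let ?Lt = "left_end (org T) (pit T) (len T)" and ?Lb = "left_end (org T) (pib T) (len T)"
  let ?Mt = "left_end (org ?T) (pit ?T) (len ?T)" and ?Mb = "left_end (org ?T) (pib ?T) (len ?T)"
  note nt = no_connection_no_tie[OF iem nc]
  note f = step_facts[OF iem nt]
  have iem': "is_iem ?T" by (rule is_iem_rauzy_step[OF iem nt])
  have b': "bij_betw (pib ?T) UNIV {1..CARD('a)}"
    using iem' by (auto simp: is_iem_def irreducible_pair_def)
  have org: "org ?T = org T" by (simp add: rauzy_step_def)
  note M = left_end_rauzy_step[OF iem nt, where \<delta>' = "len ?T" and u = "org T",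
      folded len_rauzy_step[OF iem nt]]
  have d: "CARD('a) > 1" using iem by (simp add: is_iem_def)
  have tot: "?Lt (last_top T) + len T $ last_top T = org T + total_len T"
    "?Lb (last_bot T) + len T $ last_bot T = org T + total_len T"
    using left_end_total[OF f(1,3)] left_end_total[OF f(2,4)] by (auto simp: total_len_def)
  have pos: "0 < len T $ \<alpha>" for \<alpha> by (rule f(5))
  define J where "J = {org ?T ..< org ?T + total_len ?T}"
  have ret: "\<exists>k. iem_map ?T x = (iem_map T ^^ k) x" if "x \<in> J" for x
    using rauzy_step_first_return(1)[OF iem nt] rauzy_step_first_return(2)[OF iem nt, of x] that
    unfolding J_def first_return_def by metis
  have iter: "(iem_map ?T ^^ m) x \<in> J \<and> (\<exists>k. (iem_map ?T ^^ m) x = (iem_map T ^^ k) x)"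
    if "x \<in> J" for m x
  proof (induction m)
    case 0
    then show ?case using that by (auto intro: exI[of _ 0])
  next
    case (Suc m)
    then obtain k where k: "(iem_map ?T ^^ m) x = (iem_map T ^^ k) x" "(iem_map ?T ^^ m) x \<in> J" by blast
    obtain k' where k': "iem_map ?T ((iem_map ?T ^^ m) x) = (iem_map T ^^ k') ((iem_map ?T ^^ m) x)"
      using ret k(2) by blast
    then have "(iem_map ?T ^^ Suc m) x = (iem_map T ^^ (k' + k)) x" using k(1) by (simp add: funpow_add)
    moreover have "(iem_map ?T ^^ Suc m) x \<in> J"
      using iem_map_in_interval[OF iem'] k(2) by (simp add: J_def)
    ultimately show ?case by blast
  qed
  \<comment> \<open>If the top wins, the one new bottom separator is the image of the last bottom separator.\<close>
  have bot: "\<exists>k. ?Mb \<beta> = (iem_map T ^^ k) (?Lb \<beta>) \<and> pib T \<beta> > 1" if "pib ?T \<beta> > 1" for \<beta>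
  proof (cases "top_wins T \<and> \<beta> = ?l")
    case True
    then have wl: "?w = last_top T" "?l = last_bot T" by (auto simp: winner_def loser_def)
    have "?Lb ?l \<in> top_int T ?w" using tot f(9) pos[of ?l] by (auto simp: top_int_def wl)
    then have "iem_map T (?Lb ?l) = ?Mb ?l"
      using True tot unfolding iem_map_eq[OF iem \<open>?Lb ?l \<in> top_int T ?w\<close>] org M by (auto simp: wl)
    then show ?thesis using True f(4) d by (intro exI[of _ 1]) (auto simp: wl)
  next
    case False
    have "1 \<le> pib T ?w" using bij_range(1)[OF f(2)] .
    then have "pib T \<beta> > 1"
      using that False by (cases "top_wins T") (auto simp: rauzy_step_def move_after_def split: if_splits)
    then show ?thesis using False by (intro exI[of _ 0]) (auto simp: org M)
  qed
  \<comment> \<open>If the bottom wins, the one new top separator is the preimage of the last top separator.\<close>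
  have top: "\<exists>k. (iem_map T ^^ k) (?Mt \<alpha>) = ?Lt \<alpha> \<and> pit T \<alpha> > 1" if "pit ?T \<alpha> > 1" for \<alpha>
  proof (cases "\<not> top_wins T \<and> \<alpha> = ?l")
    case True
    then have wl: "?w = last_bot T" "?l = last_top T" by (auto simp: winner_def loser_def)
    have x: "?Mt ?l = ?Lt ?w + len T $ ?w - len T $ ?l" using True unfolding org M by simp
    then have "?Mt ?l \<in> top_int T ?w" using f(9) pos[of ?l] by (auto simp: top_int_def)
    then have "iem_map T (?Mt ?l) = ?Lt ?l"
      using tot x iem_map_eq[OF iem \<open>?Mt ?l \<in> top_int T ?w\<close>] by (simp add: wl)
    then show ?thesis using True f(3) d by (intro exI[of _ 1]) (auto simp: wl)
  next
    case False
    have "1 \<le> pit T ?w" using bij_range(1)[OF f(1)] .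
    then have "pit T \<alpha> > 1"
      using that False by (cases "top_wins T") (auto simp: rauzy_step_def move_after_def split: if_splits)
    then show ?thesis using False by (intro exI[of _ 0]) (auto simp: org M)
  qed
  show ?thesis
    unfolding no_connection_iff[OF iem']
  proof (intro allI impI notI)
    fix \<alpha> \<beta> m
    assume a: "1 < pit ?T \<alpha>" and b: "1 < pib ?T \<beta>" and c: "(iem_map ?T ^^ m) (?Mb \<beta>) = ?Mt \<alpha>"
    obtain k1 where k1: "?Mb \<beta> = (iem_map T ^^ k1) (?Lb \<beta>)" "pib T \<beta> > 1" using bot[OF b] by blast
    obtain k3 where k3: "(iem_map T ^^ k3) (?Mt \<alpha>) = ?Lt \<alpha>" "pit T \<alpha> > 1" using top[OF a] by blast
    have "len ?T $ \<beta> > 0" using iem' by (auto simp: is_iem_def pos_cone_def)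
    then have "?Mb \<beta> \<in> J"
      using left_end_in_interval[OF iem' b', of \<beta>] unfolding J_def by auto
    then obtain k2 where k2: "(iem_map ?T ^^ m) (?Mb \<beta>) = (iem_map T ^^ k2) (?Mb \<beta>)"
      using iter by blast
    have "(iem_map T ^^ (k3 + (k2 + k1))) (?Lb \<beta>) = ?Lt \<alpha>"
      unfolding funpow_add o_apply k1(1)[symmetric] k2[symmetric] c k3(1) ..
    then show False using nc k1(2) k3(2) unfolding no_connection_iff[OF iem] by blast
  qed
qed

section \<open>Matrices of the algorithm and their norms\<close>

lemma RV_simps [simp]: "RV T 0 = T" "RV T (Suc n) = rauzy_step (RV T n)"
  by (simp_all add: RV_def)

lemma RV_matrix_below: "n \<le> m \<Longrightarrow> RV_matrix T m n = mat 1"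
  by (cases n) auto

lemma RV_matrix_Suc: "m \<le> n \<Longrightarrow> RV_matrix T m (Suc n) = step_matrix (RV T n) ** RV_matrix T m n"
  by simp

lemma RV_matrix_mult:
  assumes "m \<le> n" "n \<le> p"
  shows "RV_matrix T m p = RV_matrix T n p ** RV_matrix T m n"
  using assms(2)
proof (induction p rule: dec_induct)
  case (step p)
  then show ?case
    using assms(1) by (simp add: RV_matrix_Suc matrix_mul_assoc del: RV_matrix.simps)
qed (simp add: RV_matrix_below del: RV_matrix.simps)

lemma matrix_entry: "(A :: real^'a::finite^'b::finite) $ \<beta> $ \<alpha> = (A *v axis \<alpha> 1) $ \<beta>"
  by (simp add: matrix_vector_mult_basis column_def)

text \<open>The matrices dominate the identity.\<close>

lemma RV_matrix_mult_ge:
  assumes "\<And>\<gamma>. v $ \<gamma> \<ge> 0"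
  shows "v $ \<gamma> \<le> (RV_matrix T m n *v v) $ \<gamma>"
proof (cases "m \<le> n")
  case True
  then show ?thesis
  proof (induction n arbitrary: \<gamma> rule: dec_induct)
    case base
    then show ?case by (simp add: RV_matrix_below)
  next
    case (step n)
    have "0 \<le> (RV_matrix T m n *v v) $ winner (RV T n)"
      using assms step.IH order_trans by blast
    then show ?case
      using step.IH[of \<gamma>] step(1)
      by (simp add: RV_matrix_Suc step_matrix_mult_component matrix_vector_mul_assoc[symmetric]
          del: RV_matrix.simps) auto
  qed
qed (simp add: RV_matrix_below)

lemma RV_matrix_mult_mono:
  assumes "\<And>\<gamma>. v $ \<gamma> \<ge> 0" "m \<le> n" "n \<le> p"
  shows "(RV_matrix T m n *v v) $ \<gamma> \<le> (RV_matrix T m p *v v) $ \<gamma>"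
  unfolding RV_matrix_mult[OF assms(2,3)] matrix_vector_mul_assoc[symmetric]
  by (intro RV_matrix_mult_ge order_trans[OF assms(1) RV_matrix_mult_ge] assms(1))

lemma positive_matrix_mult_ge_sum:
  fixes A :: "real^'n::finite^'m::finite"
  assumes "\<And>\<alpha> \<beta>. A $ \<alpha> $ \<beta> \<ge> 1" "\<And>\<beta>. v $ \<beta> \<ge> 0"
  shows "(\<Sum>\<beta>\<in>UNIV. v $ \<beta>) \<le> (A *v v) $ \<alpha>"
proof -
  have "1 * v $ \<beta> \<le> A $ \<alpha> $ \<beta> * v $ \<beta>" for \<beta> using assms by (intro mult_right_mono) auto
  then show ?thesis unfolding matrix_vector_mult_def by (auto intro!: sum_mono)
qed

lemma row_sum_le_mnorm: "(\<Sum>\<beta>\<in>UNIV. \<bar>B $ \<alpha> $ \<beta>\<bar>) \<le> mnorm B"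
  unfolding mnorm_def by (intro Max_ge) auto

lemma mnorm_mult: "mnorm (A ** B) \<le> mnorm A * mnorm (B :: real^'a::finite^'a)"
  unfolding mnorm_def[of "A ** B"]
proof (rule Max.boundedI)
  fix x assume "x \<in> range (\<lambda>\<alpha>. \<Sum>\<beta>\<in>UNIV. \<bar>(A ** B) $ \<alpha> $ \<beta>\<bar>)"
  then obtain \<alpha> where "x = (\<Sum>\<beta>\<in>UNIV. \<bar>(A ** B) $ \<alpha> $ \<beta>\<bar>)" by blast
  also have "\<dots> \<le> (\<Sum>\<beta>\<in>UNIV. \<Sum>\<gamma>\<in>UNIV. \<bar>A $ \<alpha> $ \<gamma>\<bar> * \<bar>B $ \<gamma> $ \<beta>\<bar>)"
    unfolding matrix_matrix_mult_def by (auto simp: abs_mult[symmetric] intro!: sum_mono)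
  also have "\<dots> = (\<Sum>\<gamma>\<in>UNIV. \<bar>A $ \<alpha> $ \<gamma>\<bar> * (\<Sum>\<beta>\<in>UNIV. \<bar>B $ \<gamma> $ \<beta>\<bar>))"
    unfolding sum_distrib_left by (rule sum.swap)
  also have "\<dots> \<le> (\<Sum>\<gamma>\<in>UNIV. \<bar>A $ \<alpha> $ \<gamma>\<bar> * mnorm B)"
    by (intro sum_mono mult_left_mono row_sum_le_mnorm) auto
  also have "\<dots> = (\<Sum>\<gamma>\<in>UNIV. \<bar>A $ \<alpha> $ \<gamma>\<bar>) * mnorm B" by (simp add: sum_distrib_right)
  also have "\<dots> \<le> mnorm A * mnorm B"
  proof (rule mult_right_mono[OF row_sum_le_mnorm])
    have "0 \<le> (\<Sum>\<beta>\<in>UNIV. \<bar>B $ \<alpha> $ \<beta>\<bar>)" by (intro sum_nonneg) auto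
    then show "0 \<le> mnorm B" using row_sum_le_mnorm order_trans by blast
  qed
  finally show "x \<le> mnorm A * mnorm B" .
qed auto

lemma mnorm_RV_matrix_ge_1: "1 \<le> mnorm (RV_matrix T m n)"
proof -
  obtain \<alpha> :: 'a where True by simp
  have "axis \<alpha> 1 $ \<alpha> \<le> (RV_matrix T m n *v axis \<alpha> 1) $ \<alpha>"
    by (rule RV_matrix_mult_ge) (simp add: axis_def)
  then have "1 \<le> RV_matrix T m n $ \<alpha> $ \<alpha>" by (simp add: matrix_entry[symmetric])
  also have "\<dots> \<le> \<bar>RV_matrix T m n $ \<alpha> $ \<alpha>\<bar>" by simp
  also have "\<dots> \<le> (\<Sum>\<beta>\<in>UNIV. \<bar>RV_matrix T m n $ \<alpha> $ \<beta>\<bar>)" by (rule member_le_sum) auto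
  finally show ?thesis using row_sum_le_mnorm order_trans by blast
qed

section \<open>Every letter wins infinitely often\<close>

lemma initial_segment:
  assumes "bij_betw p (UNIV :: 'a::finite set) {1..CARD('a)}"
    and "\<And>\<alpha> \<beta>. \<alpha> \<in> S \<Longrightarrow> \<beta> \<notin> S \<Longrightarrow> p \<alpha> < p \<beta>"
  shows "S = p -` {1..card S}"
proof -
  note r = bij_range[OF assms(1)]
  have count: "p \<alpha> = card {\<beta>. p \<beta> \<le> p \<alpha>}" for \<alpha>
  proof -
    have "p ` {\<beta>. p \<beta> \<le> p \<alpha>} = {1..p \<alpha>}"
    proof
      show "{1..p \<alpha>} \<subseteq> p ` {\<beta>. p \<beta> \<le> p \<alpha>}"
      proof
        fix x assume x: "x \<in> {1..p \<alpha>}"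
        then have "x \<in> p ` UNIV" using assms(1) r(2)[of \<alpha>] by (auto simp: bij_betw_def)
        then show "x \<in> p ` {\<beta>. p \<beta> \<le> p \<alpha>}" using x by auto
      qed
    qed (use r in auto)
    then show ?thesis using card_image[of p "{\<beta>. p \<beta> \<le> p \<alpha>}"] r(3)
      by (metis card_atLeastAtMost diff_Suc_1 inj_on_subset subset_UNIV)
  qed
  have "p \<alpha> \<le> card S" if "\<alpha> \<in> S" for \<alpha>
  proof -
    have "{\<beta>. p \<beta> \<le> p \<alpha>} \<subseteq> S" using assms(2)[OF that] by (force simp: not_less[symmetric])
    then have "card {\<beta>. p \<beta> \<le> p \<alpha>} \<le> card S" by (intro card_mono) auto
    then show ?thesis using count[of \<alpha>] by simp
  qed
  moreover have "card S < p \<alpha>" if "\<alpha> \<notin> S" for \<alpha>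
  proof -
    have "insert \<alpha> S \<subseteq> {\<beta>. p \<beta> \<le> p \<alpha>}" using assms(2) that by (force intro: less_imp_le)
    then have "card (insert \<alpha> S) \<le> card {\<beta>. p \<beta> \<le> p \<alpha>}" by (intro card_mono) auto
    then show ?thesis using count[of \<alpha>] that by simp
  qed
  ultimately show ?thesis using r(1) by (force simp: not_less[symmetric])
qed

lemma eventually_constant_nat:
  fixes f :: "nat \<Rightarrow> nat"
  assumes "\<And>n. n \<ge> N \<Longrightarrow> f n \<le> f (Suc n)" "\<And>n. f n \<le> B"
  shows "\<exists>M\<ge>N. \<forall>n\<ge>M. f n = f M"
proof -
  define m where "m = Max (f ` {N..})"
  have fin: "finite (f ` {N..})" using assms(2) unfolding finite_nat_set_iff_bounded_le by blast
  have "m \<in> f ` {N..}" unfolding m_def by (rule Max_in[OF fin]) auto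
  then obtain M where M: "M \<ge> N" "f M = m" by auto
  have "f n = f M" if "n \<ge> M" for n
  proof (rule antisym)
    show "f n \<le> f M" using that M fin unfolding M(2) m_def by (intro Max_ge) auto
    show "f M \<le> f n" using that
      by (induction n rule: dec_induct) (use assms(1) M(1) order_trans in \<open>auto intro: order_trans\<close>)
  qed
  then show ?thesis using M(1) by blast
qed

context
  fixes T :: "'a::finite iem"
  assumes iem: "is_iem T" and nc: "no_connection T"
begin

lemma RV_inherits: "is_iem (RV T n) \<and> no_connection (RV T n)"
proof (induction n)
  case (Suc n)
  then show ?case
    using is_iem_rauzy_step[OF _ no_connection_no_tie] no_connection_rauzy_step by (metis RV_simps(2))
qed (simp add: iem nc)

lemmas RV_iem = RV_inherits[THEN conjunct1]

lemmas RV_no_tie = no_connection_no_tie[OF RV_inherits[THEN conjunct1] RV_inherits[THEN conjunct2]]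

lemmas RV_step_facts = step_facts[OF RV_iem RV_no_tie]

lemma RV_len_component:
  "len (RV T (Suc n)) $ \<alpha> =
     len (RV T n) $ \<alpha> - (if \<alpha> = winner (RV T n) then len (RV T n) $ loser (RV T n) else 0)"
  by (simp add: rauzy_step_def)

text \<open>These are the decrements of the total length, which decreases and is bounded below.\<close>

lemma len_loser_tendsto_0: "(\<lambda>n. len (RV T n) $ loser (RV T n)) \<longlonglongrightarrow> 0"
proof -
  let ?t = "\<lambda>n. total_len (RV T n)"
  have s: "?t (Suc n) = ?t n - len (RV T n) $ loser (RV T n)" for n
    using total_len_rauzy_step[OF RV_iem RV_no_tie] by simp
  have "?t n \<ge> 0" for n unfolding total_len_def by (intro sum_nonneg less_imp_le RV_step_facts(5))
  moreover have "decseq ?t"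
    by (intro decseq_SucI) (simp only: s diff_le_eq le_add_same_cancel1 less_imp_le[OF RV_step_facts(5)])
  ultimately obtain L where L: "?t \<longlonglongrightarrow> L" using decseq_convergent by metis
  have "(\<lambda>n. ?t n - ?t (Suc n)) \<longlonglongrightarrow> L - L" by (intro tendsto_diff L LIMSEQ_Suc)
  then show ?thesis by (simp add: s del: RV_simps)
qed

text \<open>Only the loser jumps to the left; all other letters stay in place or make room for it.\<close>

lemma RV_order_step:
  assumes "\<alpha> \<noteq> loser (RV T n)"
  shows "pit (RV T n) \<alpha> \<le> pit (RV T (Suc n)) \<alpha>" "pib (RV T n) \<alpha> \<le> pib (RV T (Suc n)) \<alpha>"
    and "pit (RV T (Suc n)) \<alpha> < pit (RV T (Suc n)) \<beta> \<Longrightarrow> pit (RV T n) \<alpha> < pit (RV T n) \<beta>"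
    and "pib (RV T (Suc n)) \<alpha> < pib (RV T (Suc n)) \<beta> \<Longrightarrow> pib (RV T n) \<alpha> < pib (RV T n) \<beta>"
proof -
  note f = RV_step_facts[of n]
  have lt: "pit (RV T n) \<alpha> < CARD('a)" if "\<not> top_wins (RV T n)"
    using that assms f(3) bij_range[OF f(1)] by (metis injD le_neq_implies_less loser_def)
  have lb: "pib (RV T n) \<alpha> < CARD('a)" if "top_wins (RV T n)"
    using that assms f(4) bij_range[OF f(2)] by (metis injD le_neq_implies_less loser_def)
  show "pit (RV T n) \<alpha> \<le> pit (RV T (Suc n)) \<alpha>" "pib (RV T n) \<alpha> \<le> pib (RV T (Suc n)) \<alpha>"
    using assms by (auto simp: rauzy_step_def move_after_def)
  show "pit (RV T (Suc n)) \<alpha> < pit (RV T (Suc n)) \<beta> \<Longrightarrow> pit (RV T n) \<alpha> < pit (RV T n) \<beta>"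
    using assms lt f(3)
    by (auto simp: rauzy_step_def move_after_def loser_def split: if_splits)
  show "pib (RV T (Suc n)) \<alpha> < pib (RV T (Suc n)) \<beta> \<Longrightarrow> pib (RV T n) \<alpha> < pib (RV T n) \<beta>"
    using assms lb f(4)
    by (auto simp: rauzy_step_def move_after_def loser_def split: if_splits)
qed

text \<open>In the row where the winner is last this is clear; in the other row, the letters to the right of the
  winner are shifted when the loser is inserted.\<close>

lemma RV_order_fixed:
  assumes "\<alpha> \<noteq> loser (RV T n)" "\<alpha> \<noteq> winner (RV T n)"
    and "pit (RV T (Suc n)) \<alpha> = pit (RV T n) \<alpha>" "pib (RV T (Suc n)) \<alpha> = pib (RV T n) \<alpha>"
  shows "pit (RV T n) \<alpha> < pit (RV T n) (winner (RV T n))"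
    and "pib (RV T n) \<alpha> < pib (RV T n) (winner (RV T n))"
proof -
  note f = RV_step_facts[of n]
  have "pit (RV T n) \<alpha> \<noteq> pit (RV T n) (winner (RV T n))" "pib (RV T n) \<alpha> \<noteq> pib (RV T n) (winner (RV T n))"
    using bij_range(3)[OF f(1)] bij_range(3)[OF f(2)] assms(2) by (auto simp: inj_eq)
  moreover have "pit (RV T n) \<alpha> \<le> CARD('a)" "pib (RV T n) \<alpha> \<le> CARD('a)"
    using bij_range(2)[OF f(1)] bij_range(2)[OF f(2)] by auto
  ultimately show "pit (RV T n) \<alpha> < pit (RV T n) (winner (RV T n))"
    "pib (RV T n) \<alpha> < pib (RV T n) (winner (RV T n))"
    using assms f(3,4)
    by (auto simp: rauzy_step_def move_after_def winner_def loser_def split: if_splits)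
qed

text \<open>Suppose that the letters in a nonempty set \<open>A\<close> stop winning.  They eventually stop losing as well
  and come to rest in both rows.  All later winners stand to their right, and \<open>A\<close> occupies the same
  initial segment of both rows.  This contradicts irreducibility.\<close>

theorem winner_infinitely_often: "\<exists>\<^sub>\<infinity>n. winner (RV T n) = \<alpha>"
proof -
  define A where "A = {\<alpha>. \<forall>\<^sub>\<infinity>n. winner (RV T n) \<noteq> \<alpha>}"
  have "\<forall>\<^sub>\<infinity>n. \<forall>\<alpha>\<in>A. winner (RV T n) \<noteq> \<alpha>"
    by (rule eventually_ball_finite) (auto simp: A_def)
  then obtain N1 where N1: "\<And>n. n \<ge> N1 \<Longrightarrow> winner (RV T n) \<notin> A"
    unfolding MOST_nat_le by blast
  \<comment> \<open>A letter that has stopped winning has constant length, but the lengths of the losers tend to zero.\<close>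
  have "\<forall>\<^sub>\<infinity>n. loser (RV T n) \<noteq> \<alpha>" if a: "\<alpha> \<in> A" for \<alpha>
  proof -
    have const: "len (RV T n) $ \<alpha> = len (RV T N1) $ \<alpha>" if "n \<ge> N1" for n
      using that
    proof (induction n rule: dec_induct)
      case (step n)
      then have "\<alpha> \<noteq> winner (RV T n)" using N1 a by blast
      then show ?case using step unfolding RV_len_component by simp
    qed simp
    have "eventually (\<lambda>n. len (RV T n) $ loser (RV T n) < len (RV T N1) $ \<alpha>) sequentially"
      by (rule order_tendstoD(2)[OF len_loser_tendsto_0 RV_step_facts(5)])
    then obtain M where "\<And>n. n \<ge> M \<Longrightarrow> len (RV T n) $ loser (RV T n) < len (RV T N1) $ \<alpha>"
      unfolding eventually_sequentially by blast
    then have "\<forall>n\<ge>max M N1. loser (RV T n) \<noteq> \<alpha>" by (metis const less_irrefl max.bounded_iff)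
    then show ?thesis unfolding MOST_nat_le by blast
  qed
  then have "\<forall>\<^sub>\<infinity>n. \<forall>\<alpha>\<in>A. loser (RV T n) \<noteq> \<alpha>" by (simp add: eventually_ball_finite_distrib)
  then obtain N2' where "\<And>n. n \<ge> N2' \<Longrightarrow> loser (RV T n) \<notin> A"
    unfolding MOST_nat_le by blast
  then obtain N2 where N2: "\<And>n. n \<ge> N2 \<Longrightarrow> winner (RV T n) \<notin> A \<and> loser (RV T n) \<notin> A"
    using N1 by (metis nle_le order_trans)
  have bij: "bij_betw (pit (RV T n)) UNIV {1..CARD('a)}" "bij_betw (pib (RV T n)) UNIV {1..CARD('a)}" for n
    by (rule RV_step_facts)+
  \<comment> \<open>A letter that no longer loses can only move to the right, so it comes to rest.\<close>
  have "\<forall>\<^sub>\<infinity>n. pit (RV T (Suc n)) \<alpha> = pit (RV T n) \<alpha> \<and> pib (RV T (Suc n)) \<alpha> = pib (RV T n) \<alpha>"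
    if a: "\<alpha> \<in> A" for \<alpha>
  proof -
    have ne: "\<alpha> \<noteq> loser (RV T n)" if "n \<ge> N2" for n using N2[OF that] a by auto
    obtain M1 where M1: "\<forall>n\<ge>M1. pit (RV T n) \<alpha> = pit (RV T M1) \<alpha>"
      using eventually_constant_nat[of N2 "\<lambda>n. pit (RV T n) \<alpha>", OF RV_order_step(1)[OF ne] bij_range(2)[OF bij(1)]] by blast
    obtain M2 where M2: "\<forall>n\<ge>M2. pib (RV T n) \<alpha> = pib (RV T M2) \<alpha>"
      using eventually_constant_nat[of N2 "\<lambda>n. pib (RV T n) \<alpha>", OF RV_order_step(2)[OF ne] bij_range(2)[OF bij(2)]] by blast
    have "\<forall>n\<ge>max M1 M2. pit (RV T (Suc n)) \<alpha> = pit (RV T n) \<alpha> \<and> pib (RV T (Suc n)) \<alpha> = pib (RV T n) \<alpha>"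
      using M1 M2 by (metis le_SucI max.bounded_iff)
    then show ?thesis unfolding MOST_nat_le by blast
  qed
  then have "\<forall>\<^sub>\<infinity>n. \<forall>\<alpha>\<in>A. pit (RV T (Suc n)) \<alpha> = pit (RV T n) \<alpha> \<and> pib (RV T (Suc n)) \<alpha> = pib (RV T n) \<alpha>"
    by (simp add: eventually_ball_finite_distrib)
  then obtain N3' where N3': "\<And>n \<alpha>. n \<ge> N3' \<Longrightarrow> \<alpha> \<in> A \<Longrightarrow>
      pit (RV T (Suc n)) \<alpha> = pit (RV T n) \<alpha> \<and> pib (RV T (Suc n)) \<alpha> = pib (RV T n) \<alpha>"
    unfolding MOST_nat_le by blast
  define N where "N = max N2 N3'"
  have win: "pit (RV T n) \<alpha> < pit (RV T n) (winner (RV T n)) \<and>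
      pib (RV T n) \<alpha> < pib (RV T n) (winner (RV T n))" if "n \<ge> N" "\<alpha> \<in> A" for n \<alpha>
    using RV_order_fixed[of \<alpha> n] N2[of n] N3'[of n \<alpha>] that unfolding N_def by auto
  \<comment> \<open>A letter outside \<open>A\<close> wins at some later time, and is then to the right of \<open>A\<close> in both rows.  Going
    back in time, it cannot cross a letter of \<open>A\<close>.\<close>
  have left: "pit (RV T N) \<alpha> < pit (RV T N) \<beta> \<and> pib (RV T N) \<alpha> < pib (RV T N) \<beta>"
    if a: "\<alpha> \<in> A" and b: "\<beta> \<notin> A" for \<alpha> \<beta>
  proof -
    have "\<exists>\<^sub>\<infinity>n. winner (RV T n) = \<beta>" using b unfolding A_def frequently_def mem_Collect_eq .
    then obtain M where M: "M \<ge> N" "winner (RV T M) = \<beta>" unfolding INFM_nat_le by blast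
    from M(1) have "pit (RV T N) \<alpha> < pit (RV T N) \<beta> \<and> pib (RV T N) \<alpha> < pib (RV T N) \<beta>"
    proof (induction rule: inc_induct)
      case base
      then show ?case using win[OF M(1) a] M(2) by simp
    next
      case (step n)
      have "\<alpha> \<noteq> loser (RV T n)" using N2[of n] a step(1) unfolding N_def by auto
      then show ?case using RV_order_step(3,4) step(3) by blast
    qed
    then show ?thesis .
  qed
  have seg: "A = pit (RV T N) -` {1..card A}" "A = pib (RV T N) -` {1..card A}"
    using initial_segment[OF bij(1), of A N] initial_segment[OF bij(2), of A N] left by blast+
  have "card A < CARD('a)"
    using N1[OF order_refl] by (metis UNIV_I card_seteq finite not_le subset_UNIV)
  moreover have "pit (RV T N) -` {1..k} \<noteq> pib (RV T N) -` {1..k}" if "1 \<le> k" "k < CARD('a)" for k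
    using RV_iem[of N] that by (auto simp: is_iem_def irreducible_pair_def)
  ultimately have "card A = 0" using seg by (metis less_one not_le)
  then have "\<alpha> \<notin> A" by simp
  then show ?thesis unfolding A_def frequently_def mem_Collect_eq .
qed

section \<open>The matrices become positive\<close>

text \<open>A single edge is a path, and each step subdivides it.\<close>

lemma RV_matrix_column_path:
  assumes "m \<le> n"
  shows "\<exists>xs. edge_path (pit (RV T n)) (pib (RV T n)) xs \<and> RV_matrix T m n *v axis \<alpha> 1 = occurrences xs"
  using assms
proof (induction n rule: dec_induct)
  case base
  then show ?case
    by (intro exI[of _ "[\<alpha>]"]) (simp add: edge_path_def RV_matrix_below)
next
  case (step n)
  then obtain xs where xs: "edge_path (pit (RV T n)) (pib (RV T n)) xs"
      "RV_matrix T m n *v axis \<alpha> 1 = occurrences xs" by blast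
  from path_rauzy_step[OF RV_iem RV_no_tie xs(1)] xs(2) step(1) show ?case
    by (auto simp: RV_matrix_Suc matrix_vector_mul_assoc[symmetric] occurrences_rauzy_step[OF RV_iem RV_no_tie]
        simp del: RV_matrix.simps)
qed

lemma RV_matrix_Nats: "RV_matrix T m n $ \<beta> $ \<alpha> \<in> \<nat>"
proof (cases "m \<le> n")
  case True
  then show ?thesis using RV_matrix_column_path[OF True, of \<alpha>] occurrences_Nats by (metis matrix_entry)
qed (simp add: RV_matrix_below mat_def)

lemma RV_matrix_nonneg: "RV_matrix T m n $ \<beta> $ \<alpha> \<ge> 0"
  using RV_matrix_Nats by (metis Nats_cases of_nat_0_le_iff)

text \<open>Let \<open>S\<close> be the set of letters at which the column ever becomes positive.  At late times the loser
  is in \<open>S\<close> whenever the winner is.  If a letter outside \<open>S\<close> wins at a late time, all later winners are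
  outside \<open>S\<close>, although the letters of \<open>S\<close> also win infinitely often.\<close>

lemma RV_matrix_column_positive: "\<forall>\<^sub>\<infinity>n. \<forall>\<alpha>. RV_matrix T m n $ \<alpha> $ \<beta> > 0"
proof -
  define c where "c n \<alpha> = RV_matrix T m n $ \<alpha> $ \<beta>" for n \<alpha>
  define S where "S = {\<alpha>. \<exists>n\<ge>m. c n \<alpha> > 0}"
  have step: "c (Suc n) \<gamma> = c n \<gamma> + (if \<gamma> = loser (RV T n) then c n (winner (RV T n)) else 0)"
    if "m \<le> n" for n \<gamma>
    using that unfolding c_def matrix_entry RV_matrix_Suc[OF that] matrix_vector_mul_assoc[symmetric]
    by (simp add: step_matrix_mult_component)
  have mono: "c n \<gamma> \<le> c p \<gamma>" if "m \<le> n" "n \<le> p" for n p \<gamma>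
    using that unfolding c_def matrix_entry by (intro RV_matrix_mult_mono) (auto simp: axis_def)
  have "\<forall>\<^sub>\<infinity>n. c n \<alpha> > 0" if \<alpha>: "\<alpha> \<in> S" for \<alpha>
  proof -
    obtain n where "m \<le> n" "c n \<alpha> > 0" using \<alpha> unfolding S_def by blast
    then have "\<forall>p\<ge>n. c p \<alpha> > 0" using mono less_le_trans by blast
    then show ?thesis unfolding MOST_nat_le by blast
  qed
  then have "\<forall>\<^sub>\<infinity>n. \<forall>\<alpha>\<in>S. c n \<alpha> > 0" by (intro eventually_ball_finite) auto
  then obtain N' where N': "\<And>n \<alpha>. n \<ge> N' \<Longrightarrow> \<alpha> \<in> S \<Longrightarrow> c n \<alpha> > 0"
    unfolding MOST_nat_le by blast
  define N where "N = max m N'"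
  \<comment> \<open>The row of the winner is added to the row of the loser.\<close>
  have closed: "loser (RV T n) \<in> S" if "n \<ge> N" "winner (RV T n) \<in> S" for n
  proof -
    have "m \<le> n" "c n (winner (RV T n)) > 0" "c n (loser (RV T n)) \<ge> 0"
      using that N' RV_matrix_nonneg by (auto simp: N_def c_def)
    then have "c (Suc n) (loser (RV T n)) > 0" by (simp add: step del: RV_simps)
    then show ?thesis unfolding S_def using \<open>m \<le> n\<close> le_SucI by blast
  qed
  have "c m \<beta> > 0" by (simp add: c_def RV_matrix_below mat_def)
  then have \<beta>: "\<beta> \<in> S" unfolding S_def by blast
  have "S = UNIV"
  proof (rule ccontr)
    assume "S \<noteq> UNIV"
    then obtain \<gamma> where \<gamma>: "\<gamma> \<notin> S" by blast
    obtain n1 where n1: "n1 \<ge> N" "winner (RV T n1) = \<gamma>"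
      using winner_infinitely_often[of \<gamma>] unfolding INFM_nat_le by blast
    \<comment> \<open>The winner takes part in the next step.  If it is outside \<open>S\<close>, it can lose only to a letter
      outside \<open>S\<close>.\<close>
    have out: "winner (RV T n) \<notin> S" if "n \<ge> n1" for n
      using that
    proof (induction n rule: dec_induct)
      case base
      then show ?case using n1 \<gamma> by simp
    next
      case (step n)
      then show ?case
        using winner_persists[of "RV T n"] closed[of "Suc n"] n1(1) by auto
    qed
    obtain n where "n \<ge> n1" "winner (RV T n) = \<beta>"
      using winner_infinitely_often[of \<beta>] unfolding INFM_nat_le by blast
    then show False using out \<beta> by blast
  qed
  then have "\<forall>n\<ge>N. \<forall>\<alpha>. c n \<alpha> > 0" using N' by (simp add: N_def)
  then show ?thesis unfolding MOST_nat_le c_def by blast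
qed

theorem RV_matrix_positive: "\<exists>n>m. \<forall>\<alpha> \<beta>. RV_matrix T m n $ \<alpha> $ \<beta> \<ge> 1"
proof -
  have "\<forall>\<^sub>\<infinity>n. \<forall>\<beta>\<in>UNIV. \<forall>\<alpha>. RV_matrix T m n $ \<alpha> $ \<beta> > 0"
    by (intro eventually_ball_finite) (auto intro: RV_matrix_column_positive)
  then obtain N where N: "\<And>n \<alpha> \<beta>. n \<ge> N \<Longrightarrow> RV_matrix T m n $ \<alpha> $ \<beta> > 0"
    unfolding MOST_nat_le by blast
  have "RV_matrix T m n $ \<alpha> $ \<beta> \<ge> 1" if "n \<ge> N" for n \<alpha> \<beta>
  proof -
    obtain k :: nat where k: "RV_matrix T m n $ \<alpha> $ \<beta> = real k"
      using RV_matrix_Nats Nats_cases by metis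
    then show ?thesis using N[OF that, of \<alpha> \<beta>] by simp
  qed
  then show ?thesis by (intro exI[of _ "Suc (max m N)"]) (auto simp del: RV_matrix.simps)
qed

text \<open>Each positive matrix at least doubles the column sums.  This makes the greatest \<open>k\<close> in the theorem
  exist.\<close>

lemma RV_column_sum_unbounded:
  "\<exists>N\<ge>m. \<forall>n\<ge>N. (\<Sum>\<beta>\<in>UNIV. RV_matrix T m n $ \<beta> $ \<alpha>) \<ge> r"
proof -
  have ax: "axis \<alpha> 1 $ \<gamma> \<ge> (0::real)" for \<gamma> by (simp add: axis_def)
  have "\<exists>n\<ge>m. (\<Sum>\<beta>\<in>UNIV. RV_matrix T m n $ \<beta> $ \<alpha>) \<ge> 2 ^ k" for k
  proof (induction k)
    case 0
    have "(\<Sum>\<beta>\<in>UNIV. RV_matrix T m m $ \<beta> $ \<alpha>) = 1" by (simp add: RV_matrix_below mat_def)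
    then show ?case by (intro exI[of _ m]) simp
  next
    case (Suc k)
    then obtain n where n: "n \<ge> m" "(\<Sum>\<beta>\<in>UNIV. RV_matrix T m n $ \<beta> $ \<alpha>) \<ge> 2 ^ k" by blast
    obtain p where p: "p > n" "\<And>\<alpha> \<beta>. RV_matrix T n p $ \<alpha> $ \<beta> \<ge> 1" using RV_matrix_positive by blast
    let ?s = "\<Sum>\<beta>\<in>UNIV. RV_matrix T m n $ \<beta> $ \<alpha>"
    have "?s \<le> RV_matrix T m p $ \<gamma> $ \<alpha>" for \<gamma>
      unfolding RV_matrix_mult[OF n(1) less_imp_le[OF p(1)]] matrix_entry matrix_vector_mul_assoc[symmetric]
      by (intro positive_matrix_mult_ge_sum p(2)) (simp add: RV_matrix_nonneg matrix_entry[symmetric])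
    then have "real CARD('a) * ?s \<le> (\<Sum>\<gamma>\<in>UNIV. RV_matrix T m p $ \<gamma> $ \<alpha>)"
      using sum_bounded_below[of UNIV ?s "\<lambda>\<gamma>. RV_matrix T m p $ \<gamma> $ \<alpha>"] by simp
    moreover have "2 * 2 ^ k \<le> real CARD('a) * ?s"
      using iem n(2) by (intro mult_mono) (auto simp: is_iem_def)
    ultimately show ?case using n(1) p(1) by (intro exI[of _ p]) auto
  qed
  moreover obtain k where "r < 2 ^ k" using real_arch_pow[of 2 r] by auto
  ultimately obtain N where N: "N \<ge> m" "r \<le> (\<Sum>\<beta>\<in>UNIV. RV_matrix T m N $ \<beta> $ \<alpha>)"
    by (meson less_imp_le order_trans)
  have "r \<le> (\<Sum>\<beta>\<in>UNIV. RV_matrix T m n $ \<beta> $ \<alpha>)" if "n \<ge> N" for n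
    using N(2) unfolding matrix_entry
    by (rule order_trans) (intro sum_mono RV_matrix_mult_mono N(1) that ax)
  then show ?thesis using N(1) by blast
qed

section \<open>Lengths, cones and marked points along the algorithm\<close>

lemma len_RV_matrix:
  assumes "m \<le> n"
  shows "len (RV T m) = len (RV T n) v* RV_matrix T m n"
  using assms
proof (induction n rule: dec_induct)
  case (step n)
  then show ?case
    using len_rauzy_step[OF RV_iem[of n] RV_no_tie[of n]]
    by (simp add: RV_matrix_Suc vector_matrix_mul_assoc[symmetric] del: RV_matrix.simps)
qed (simp add: RV_matrix_below del: RV_matrix.simps)

text \<open>The total initial length is the sum of the present lengths weighted with the row sums.\<close>

lemma total_len_le: "total_len T \<le> mnorm (RV_matrix T 0 n) * total_len (RV T n)"
proof -
  have "len T $ \<beta> = (\<Sum>\<alpha>\<in>UNIV. len (RV T n) $ \<alpha> * RV_matrix T 0 n $ \<alpha> $ \<beta>)" for \<beta>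
    using len_RV_matrix[of 0 n]
    by (simp add: vector_matrix_mult_def mult.commute vec_eq_iff)
  then have "total_len T = (\<Sum>\<beta>\<in>UNIV. \<Sum>\<alpha>\<in>UNIV. len (RV T n) $ \<alpha> * RV_matrix T 0 n $ \<alpha> $ \<beta>)"
    by (simp add: total_len_def)
  also have "\<dots> = (\<Sum>\<alpha>\<in>UNIV. len (RV T n) $ \<alpha> * (\<Sum>\<beta>\<in>UNIV. RV_matrix T 0 n $ \<alpha> $ \<beta>))"
    unfolding sum_distrib_left by (rule sum.swap)
  also have "\<dots> \<le> (\<Sum>\<alpha>\<in>UNIV. len (RV T n) $ \<alpha> * mnorm (RV_matrix T 0 n))"
  proof (intro sum_mono mult_left_mono)
    fix \<alpha>
    show "(\<Sum>\<beta>\<in>UNIV. RV_matrix T 0 n $ \<alpha> $ \<beta>) \<le> mnorm (RV_matrix T 0 n)"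
      using row_sum_le_mnorm[of "RV_matrix T 0 n" \<alpha>] RV_matrix_nonneg by simp
  qed (auto intro: less_imp_le RV_step_facts(5))
  finally show ?thesis by (simp add: total_len_def sum_distrib_left mult.commute)
qed

lemma H_space_RV_matrix:
  assumes "m \<le> n" "v \<in> H_space (pit (RV T m)) (pib (RV T m))"
  shows "RV_matrix T m n *v v \<in> H_space (pit (RV T n)) (pib (RV T n))"
  using assms(1)
proof (induction n rule: dec_induct)
  case (step n)
  then show ?case
    using H_space_rauzy_step[OF RV_iem RV_no_tie step.IH]
    by (simp add: RV_matrix_Suc matrix_vector_mul_assoc del: RV_matrix.simps)
qed (simp add: RV_matrix_below assms(2) del: RV_matrix.simps)

lemma marked_points_RV:
  "marked_points (pit (RV T n)) (pib (RV T n)) \<le> marked_points (pit T) (pib T)"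
  using marked_points_rauzy_step[OF RV_iem RV_no_tie] by (induction n) (auto intro: order_trans)

text \<open>A positive matrix makes the coordinates of a vector comparable, and this survives in the closure.\<close>

lemma closure_image_subset_cone:
  assumes mn: "m \<le> n" and pos: "\<And>\<alpha> \<beta>. RV_matrix T m n $ \<alpha> $ \<beta> \<ge> 1"
  shows "closure ((\<lambda>v. RV_matrix T m n *v v) ` cone_at T m) \<subseteq> cone_at T n \<union> {0}"
proof -
  let ?B = "RV_matrix T m n" and ?H = "H_space (pit (RV T n)) (pib (RV T n))"
  \<comment> \<open>A closed set which contains the image: there, any two coordinates have a ratio of at most the norm.\<close>
  define F where "F = ?H \<inter> {x. \<forall>\<alpha>. 0 \<le> x $ \<alpha>} \<inter> {x. \<forall>\<alpha> \<beta>. x $ \<beta> \<le> mnorm ?B * x $ \<alpha>}"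
  have "closed F"
    unfolding F_def
    by (intro closed_Int closed_subspace subspace_H_space closed_Collect_all closed_Collect_le continuous_intros)
  moreover have "?B *v v \<in> F" if "v \<in> cone_at T m" for v
  proof -
    have v: "v $ \<gamma> \<ge> 0" for \<gamma> using that by (auto simp: cone_at_def H_cone_def pos_cone_def less_imp_le)
    have sum: "(\<Sum>\<gamma>\<in>UNIV. v $ \<gamma>) \<le> (?B *v v) $ \<alpha>" for \<alpha>
      by (intro positive_matrix_mult_ge_sum pos v)
    have "(?B *v v) $ \<beta> \<le> mnorm ?B * (?B *v v) $ \<alpha>" for \<alpha> \<beta>
    proof -
      have "?B $ \<beta> $ \<gamma> \<le> mnorm ?B" for \<gamma>
        using member_le_sum[of \<gamma> UNIV "\<lambda>\<gamma>. \<bar>?B $ \<beta> $ \<gamma>\<bar>"] row_sum_le_mnorm[of ?B \<beta>] by simp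
      then have "(?B *v v) $ \<beta> \<le> (\<Sum>\<gamma>\<in>UNIV. mnorm ?B * v $ \<gamma>)"
        unfolding matrix_vector_mult_def by (auto intro!: sum_mono mult_right_mono v)
      also have "\<dots> \<le> mnorm ?B * (?B *v v) $ \<alpha>"
        unfolding sum_distrib_left[symmetric]
        using mnorm_RV_matrix_ge_1[of T m n] by (intro mult_left_mono sum) auto
      finally show ?thesis .
    qed
    moreover have "0 \<le> (?B *v v) $ \<alpha>" for \<alpha> using sum[of \<alpha>] sum_nonneg[of UNIV "($) v"] v by force
    moreover have "?B *v v \<in> ?H"
      using H_space_RV_matrix[OF mn] that by (simp add: cone_at_def H_cone_def)
    ultimately show ?thesis by (simp add: F_def)
  qed
  ultimately have "closure ((\<lambda>v. ?B *v v) ` cone_at T m) \<subseteq> F"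
    by (intro closure_minimal) auto
  moreover have "x \<in> cone_at T n \<union> {0}" if x: "x \<in> F" for x
  proof (cases "x = 0")
    case False
    then obtain \<beta> where "x $ \<beta> \<noteq> 0" by (auto simp: vec_eq_iff)
    then have "0 < x $ \<beta>" using x by (auto simp: F_def order_le_less)
    then have "0 < mnorm ?B * x $ \<alpha>" for \<alpha> using x unfolding F_def by (auto intro: less_le_trans)
    then have "0 < x $ \<alpha>" for \<alpha> using mnorm_RV_matrix_ge_1[of T m n] by (simp add: zero_less_mult_iff)
    then show ?thesis using x by (simp add: F_def cone_at_def H_cone_def pos_cone_def)
  qed simp
  ultimately show ?thesis by blast
qed

section \<open>The accelerated times\<close>

text \<open>The minimum in the definition of the accelerated times is taken over a nonempty set, since every time
  at which the matrix has become positive qualifies.\<close>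

lemma nseq_Suc_works:
  "nseq T k < nseq T (Suc k) \<and>
   closure ((\<lambda>v. RV_matrix T (nseq T k) (nseq T (Suc k)) *v v) ` cone_at T (nseq T k))
     \<subseteq> cone_at T (nseq T (Suc k)) \<union> {0}"
proof -
  obtain n where "n > nseq T k" "\<And>\<alpha> \<beta>. RV_matrix T (nseq T k) n $ \<alpha> $ \<beta> \<ge> 1"
    using RV_matrix_positive by blast
  then have "\<exists>n. n > nseq T k \<and>
     closure ((\<lambda>v. RV_matrix T (nseq T k) n *v v) ` cone_at T (nseq T k)) \<subseteq> cone_at T n \<union> {0}"
    using closure_image_subset_cone[OF less_imp_le] by blast
  from LeastI_ex[OF this] show ?thesis by simp
qed

lemma strict_mono_nseq: "strict_mono (nseq T)"
  using nseq_Suc_works by (simp add: strict_mono_Suc_iff)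

text \<open>The condition on the accelerated times extends to the vectors on the boundary of the cone.\<close>

lemma nseq_step_positive:
  fixes k
  defines "m \<equiv> nseq T k" and "n \<equiv> nseq T (Suc k)"
  assumes H: "w \<in> H_space (pit (RV T m)) (pib (RV T m))" and w0: "\<And>\<alpha>. w $ \<alpha> \<ge> 0" "w \<noteq> 0"
  shows "(RV_matrix T m n *v w) $ \<alpha> > 0"
proof -
  let ?B = "RV_matrix T m n"
  obtain p where p: "p \<in> cone_at T m"
    using H_cone_nonempty RV_iem[of m] unfolding cone_at_def is_iem_def by blast
  have in_cone: "w + c *\<^sub>R p \<in> cone_at T m" if "c > 0" for c
    using p H w0(1) that unfolding cone_at_def H_cone_def pos_cone_def
    by (auto intro!: add_nonneg_pos subspace_add subspace_scale subspace_H_space)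
  \<comment> \<open>Only positive vectors are controlled by the choice of the time, so \<open>w\<close> is approached by them.\<close>
  have "(\<lambda>i. ?B *v w + inverse (real (Suc i)) *\<^sub>R (?B *v p)) \<longlonglongrightarrow> ?B *v w + 0 *\<^sub>R (?B *v p)"
    (is "?x \<longlonglongrightarrow> _") by (intro tendsto_intros LIMSEQ_inverse_real_of_nat)
  then have "?x \<longlonglongrightarrow> ?B *v w" by simp
  moreover have "?B *v w + inverse (real (Suc i)) *\<^sub>R (?B *v p) \<in> (\<lambda>v. ?B *v v) ` cone_at T m" for i
  proof
    show "w + inverse (real (Suc i)) *\<^sub>R p \<in> cone_at T m" by (rule in_cone) simp
  qed (simp add: matrix_vector_right_distrib matrix_vector_mult_scaleR)
  ultimately have "?B *v w \<in> closure ((\<lambda>v. ?B *v v) ` cone_at T m)"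
    unfolding closure_sequential by (intro exI[of _ ?x]) blast
  then have "?B *v w \<in> cone_at T n \<union> {0}" using nseq_Suc_works unfolding m_def n_def by blast
  moreover have "?B *v w \<noteq> 0"
  proof
    assume "?B *v w = 0"
    then have "w $ \<alpha> \<le> 0" for \<alpha> using RV_matrix_mult_ge[OF w0(1), of \<alpha> T m n] by simp
    then show False using w0 by (auto simp: vec_eq_iff intro: antisym)
  qed
  ultimately show ?thesis by (auto simp: cone_at_def H_cone_def pos_cone_def)
qed

text \<open>A column with sum at least \<open>s\<close> contains a closed path, which one more accelerated step makes positive in
  every coordinate.  Integrality turns positive into at least one, so each interval at the later time
  is counted at least once in the earlier interval.\<close>

lemma length_ge_total_len:
  assumes "l \<le> k"
    and big: "(\<Sum>\<beta>\<in>UNIV. RV_matrix T (nseq T l) (nseq T k) $ \<beta> $ \<alpha>) \<ge> real (marked_points (pit T) (pib T))"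
  shows "len (RV T (nseq T l)) $ \<alpha> \<ge> total_len (RV T (nseq T (Suc k)))"
proof -
  let ?l = "nseq T l" and ?m = "nseq T k" and ?n = "nseq T (Suc k)"
  have le: "?l \<le> ?m" "?m \<le> ?n" using strict_mono_nseq assms(1) by (auto simp: strict_mono_less_eq simp del: nseq.simps)
  obtain xs where xs: "edge_path (pit (RV T ?m)) (pib (RV T ?m)) xs" "RV_matrix T ?l ?m *v axis \<alpha> 1 = occurrences xs"
    using RV_matrix_column_path[OF le(1)] by blast
  have "real (marked_points (pit T) (pib T)) \<le> real (length xs)"
    using big unfolding matrix_entry xs(2) sum_occurrences .
  then have "marked_points (pit (RV T ?m)) (pib (RV T ?m)) \<le> length xs"
    using marked_points_RV[of ?m] by linarith
  from long_path_closed_subpath[OF RV_step_facts(1,2) xs(1) this] obtain as ys bs where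
    ys: "xs = as @ ys @ bs" "ys \<noteq> []" "occurrences ys \<in> H_space (pit (RV T ?m)) (pib (RV T ?m))" by blast
  let ?B = "RV_matrix T ?m ?n"
  have nn: "occurrences zs $ \<gamma> \<ge> 0" for zs :: "'a list" and \<gamma>
    using occurrences_Nats by (metis Nats_cases of_nat_0_le_iff)
  have "occurrences ys \<noteq> 0"
    using sum_occurrences[of ys] ys(2) by auto
  from nseq_step_positive[OF ys(3) nn this] have pos: "(?B *v occurrences ys) $ \<beta> > 0" for \<beta> .
  have ge1: "RV_matrix T ?l ?n $ \<beta> $ \<alpha> \<ge> 1" for \<beta>
  proof -
    have "(?B *v occurrences zs) $ \<beta> \<in> \<nat>" for zs
      by (induction zs)
        (simp_all add: matrix_vector_right_distrib matrix_entry[symmetric] RV_matrix_Nats del: nseq.simps)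
    then have "(?B *v occurrences ys) $ \<beta> \<ge> 1"
      using pos[of \<beta>] by (metis Nats_cases of_nat_0_less_iff of_nat_1 of_nat_le_iff Suc_le_eq One_nat_def)
    moreover have "(?B *v occurrences zs) $ \<beta> \<ge> 0" for zs
      using RV_matrix_mult_ge[OF nn] nn order_trans by blast
    ultimately show ?thesis
      unfolding matrix_entry RV_matrix_mult[OF le] matrix_vector_mul_assoc[symmetric] xs(2) ys(1)
      by (simp add: matrix_vector_right_distrib add_increasing add_increasing2 del: nseq.simps)
  qed
  have "total_len (RV T ?n) \<le> (\<Sum>\<beta>\<in>UNIV. len (RV T ?n) $ \<beta> * RV_matrix T ?l ?n $ \<beta> $ \<alpha>)"
    unfolding total_len_def
  proof (rule sum_mono)
    fix \<beta>
    show "len (RV T ?n) $ \<beta> \<le> len (RV T ?n) $ \<beta> * RV_matrix T ?l ?n $ \<beta> $ \<alpha>"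
      using mult_left_mono[OF ge1[of \<beta>] less_imp_le[OF RV_step_facts(5)]] by simp
  qed
  also have "\<dots> = len (RV T ?l) $ \<alpha>"
    using len_RV_matrix[OF order_trans[OF le]]
    by (simp add: vector_matrix_mult_def mult.commute vec_eq_iff del: nseq.simps)
  finally show ?thesis .
qed

text \<open>The admissible \<open>k\<close> include \<open>l\<close>, where the column is a unit vector and \<open>s > 1\<close>, and they are
  bounded since the column sums tend to infinity.\<close>

lemma last_small_column_sum:
  assumes "marked_points (pit T) (pib T) > 1"
  defines "P \<equiv> \<lambda>\<alpha> l k. l \<le> k \<and> (\<Sum>\<beta>\<in>UNIV. RV_matrix T (nseq T l) (nseq T k) $ \<beta> $ \<alpha>)
                        < real (marked_points (pit T) (pib T))"
  shows "P \<alpha> l (Greatest (P \<alpha> l))" "\<not> P \<alpha> l (Suc (Greatest (P \<alpha> l)))"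
proof -
  have start: "P \<alpha> l l" using assms(1) by (simp add: P_def RV_matrix_below mat_def)
  obtain N where N: "\<And>n. n \<ge> N \<Longrightarrow>
      (\<Sum>\<beta>\<in>UNIV. RV_matrix T (nseq T l) n $ \<beta> $ \<alpha>) \<ge> real (marked_points (pit T) (pib T))"
    using RV_column_sum_unbounded by blast
  have bound: "k \<le> N" if "P \<alpha> l k" for k
  proof (rule ccontr)
    assume "\<not> k \<le> N"
    then have "N \<le> nseq T k" using strict_mono_imp_increasing[OF strict_mono_nseq, of k] by linarith
    then show False using N that unfolding P_def by (metis not_le)
  qed
  show "P \<alpha> l (Greatest (P \<alpha> l))" by (rule GreatestI_nat[of "P \<alpha> l", OF start]) (use bound in blast)
  show "\<not> P \<alpha> l (Suc (Greatest (P \<alpha> l)))"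
    using Greatest_le_nat[of "P \<alpha> l" _ N] bound not_less_eq_eq by blast
qed

lemma mnorm_two_steps:
  assumes C: "C > 0" and \<tau>: "\<tau> > 0"
    and a': "\<And>k. k > 0 \<Longrightarrow> mnorm (RV_matrix T (nseq T (k - 1)) (nseq T k))
          \<le> C * mnorm (RV_matrix T (nseq T 0) (nseq T (k - 1))) powr \<tau>"
  shows "mnorm (RV_matrix T 0 (nseq T (Suc (Suc k))))
     \<le> C * C powr (1 + \<tau>) * mnorm (RV_matrix T 0 (nseq T k)) powr ((1 + \<tau>) * (1 + \<tau>))"
proof -
  define N where "N k = mnorm (RV_matrix T 0 (nseq T k))" for k
  have N1: "N k \<ge> 1" for k unfolding N_def by (rule mnorm_RV_matrix_ge_1)
  have step: "N (Suc k) \<le> C * N k powr (1 + \<tau>)" for k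
  proof -
    have "nseq T k \<le> nseq T (Suc k)" using strict_mono_nseq by (simp add: strict_mono_less_eq del: nseq.simps)
    then have "N (Suc k) \<le> mnorm (RV_matrix T (nseq T k) (nseq T (Suc k))) * N k"
      unfolding N_def by (subst RV_matrix_mult[of 0 "nseq T k"]) (simp_all add: mnorm_mult del: nseq.simps)
    also have "\<dots> \<le> (C * N k powr \<tau>) * N k"
      using a'[of "Suc k"] N1[of k] by (intro mult_right_mono) (auto simp: N_def simp del: nseq.simps(2))
    also have "\<dots> = C * N k powr (1 + \<tau>)" using N1[of k] by (simp add: powr_add)
    finally show ?thesis .
  qed
  have "N (Suc (Suc k)) \<le> C * N (Suc k) powr (1 + \<tau>)" by (rule step)
  also have "\<dots> \<le> C * (C * N k powr (1 + \<tau>)) powr (1 + \<tau>)"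
    using C \<tau> N1[of "Suc k"] by (intro mult_left_mono powr_mono2 step) auto
  also have "\<dots> = C * C powr (1 + \<tau>) * N k powr ((1 + \<tau>) * (1 + \<tau>))"
    using C by (simp add: powr_mult powr_powr)
  finally show ?thesis unfolding N_def .
qed

end

section \<open>The lower bound for the lengths\<close>

theorem proposition3p13:
  fixes T :: "('a::finite) iem"
  assumes "is_iem T"
    and "no_connection T"
    and "marked_points (pit T) (pib T) > 1"
    and "condition_a' T"
  shows "\<forall>\<tau>>0. \<exists>C>0. \<forall>\<alpha> l.
           let k = (GREATEST k. l \<le> k \<and>
                      (\<Sum>\<beta>\<in>UNIV. RV_matrix T (nseq T l) (nseq T k) $ \<beta> $ \<alpha>)
                        < real (marked_points (pit T) (pib T)))
           in len (RV T (nseq T l)) $ \<alpha>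
                \<ge> inverse C * total_len (RV T 0) * mnorm (RV_matrix T 0 (nseq T k)) powr (- \<tau> - 1)"
proof (intro allI impI)
  fix \<tau> :: real assume \<tau>: "\<tau> > 0"
  \<comment> \<open>Two applications of condition (a') with exponent \<open>\<sigma>\<close> give the exponent \<open>(1 + \<sigma>)\<^sup>2 \<le> 1 + 3 \<sigma>\<close>.\<close>
  define \<sigma> where "\<sigma> = min 1 (\<tau> / 3)"
  have "\<sigma> * \<sigma> \<le> \<sigma> * 1" using \<tau> unfolding \<sigma>_def by (intro mult_left_mono) auto
  then have \<sigma>: "\<sigma> > 0" "(1 + \<sigma>) * (1 + \<sigma>) \<le> 1 + \<tau>"
    using \<tau> by (auto simp: \<sigma>_def algebra_simps)
  obtain C where C: "C > 0" "\<And>k. k > 0 \<Longrightarrow> mnorm (RV_matrix T (nseq T (k - 1)) (nseq T k))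
          \<le> C * mnorm (RV_matrix T (nseq T 0) (nseq T (k - 1))) powr \<sigma>"
    using assms(4) \<sigma>(1) unfolding condition_a'_def by blast
  define D where "D = C * C powr (1 + \<sigma>)"
  have D: "D > 0" using C(1) by (simp add: D_def)
  show "\<exists>C>0. \<forall>\<alpha> l.
           let k = (GREATEST k. l \<le> k \<and>
                      (\<Sum>\<beta>\<in>UNIV. RV_matrix T (nseq T l) (nseq T k) $ \<beta> $ \<alpha>)
                        < real (marked_points (pit T) (pib T)))
           in len (RV T (nseq T l)) $ \<alpha>
                \<ge> inverse C * total_len (RV T 0) * mnorm (RV_matrix T 0 (nseq T k)) powr (- \<tau> - 1)"
    unfolding Let_def
  proof (intro exI[of _ D] conjI allI D)
    fix \<alpha> :: 'a and l
    define k where "k = (GREATEST k. l \<le> k \<and>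
                      (\<Sum>\<beta>\<in>UNIV. RV_matrix T (nseq T l) (nseq T k) $ \<beta> $ \<alpha>)
                        < real (marked_points (pit T) (pib T)))"
    let ?N = "mnorm (RV_matrix T 0 (nseq T k))" and ?n = "nseq T (Suc (Suc k))"
    note small = last_small_column_sum[OF assms(1-3), of l \<alpha>, folded k_def]
    have "l \<le> Suc k" "(\<Sum>\<beta>\<in>UNIV. RV_matrix T (nseq T l) (nseq T (Suc k)) $ \<beta> $ \<alpha>)
                        \<ge> real (marked_points (pit T) (pib T))"
      using small by (auto simp del: nseq.simps)
    then have len: "len (RV T (nseq T l)) $ \<alpha> \<ge> total_len (RV T ?n)"
      by (rule length_ge_total_len[OF assms(1,2)])
    have tot: "0 \<le> total_len T" "0 \<le> total_len (RV T ?n)"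
      using step_facts(5)[OF RV_iem[OF assms(1,2)] RV_no_tie[OF assms(1,2)]] RV_simps(1)[of T]
      unfolding total_len_def by (metis less_imp_le sum_nonneg)+
    have N: "?N \<ge> 1" by (rule mnorm_RV_matrix_ge_1)
    have "mnorm (RV_matrix T 0 ?n) \<le> D * ?N powr ((1 + \<sigma>) * (1 + \<sigma>))"
      unfolding D_def using mnorm_two_steps[OF assms(1,2) C(1) \<sigma>(1) C(2)] .
    also have "\<dots> \<le> D * ?N powr (1 + \<tau>)" using D N \<sigma>(2) by (intro mult_left_mono powr_mono) auto
    finally have norm: "mnorm (RV_matrix T 0 ?n) \<le> D * ?N powr (1 + \<tau>)" .
    have "total_len T \<le> mnorm (RV_matrix T 0 ?n) * total_len (RV T ?n)"
      by (rule total_len_le[OF assms(1,2)])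
    also have "\<dots> \<le> (D * ?N powr (1 + \<tau>)) * len (RV T (nseq T l)) $ \<alpha>"
      using norm len tot(2) D by (intro mult_mono) auto
    finally have *: "total_len T \<le> (D * ?N powr (1 + \<tau>)) * len (RV T (nseq T l)) $ \<alpha>" .
    have "?N powr (- \<tau> - 1) = inverse (?N powr (1 + \<tau>))"
      by (metis powr_minus minus_add_distrib uminus_add_conv_diff add.commute diff_conv_add_uminus)
    then have "inverse D * total_len T * ?N powr (- \<tau> - 1) = total_len T / (D * ?N powr (1 + \<tau>))"
      by (simp add: divide_inverse)
    also have "\<dots> \<le> len (RV T (nseq T l)) $ \<alpha>"
      using * D N by (subst pos_divide_le_eq) (auto simp: mult.commute)
    finally show "inverse D * total_len (RV T 0) * mnorm (RV_matrix T 0 (nseq T (GREATEST k. l \<le> k \<and>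
                      (\<Sum>\<beta>\<in>UNIV. RV_matrix T (nseq T l) (nseq T k) $ \<beta> $ \<alpha>)
                        < real (marked_points (pit T) (pib T))))) powr (- \<tau> - 1)
        \<le> len (RV T (nseq T l)) $ \<alpha>"
      unfolding k_def[symmetric] by simp
  qed
qed

end
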